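(* Let $N\ge2$. There exist a positive definite diagonal $N\times N$ matrix $A$ with constant coefficients, two disjoint open cones $\mathcal{C}_1,\mathcal{C}_2$ of $\mathbb{R}^N$, and two non-negative and non-trivial homogeneous functions $u$ and $v$ in $H^1_{\mathrm{loc}}(\mathbb{R}^N)\cap C(\mathbb{R}^N)$, of degree $\alpha_1>0$ and $\alpha_2>0$ respectively, with $\alpha_1+\alpha_2<2$, such that $$\mathrm{div}(A\nabla u)=0\ \text{ in }\mathcal{C}_1=\{u>0\},\qquad\Delta v=0\ \text{ in }\mathcal{C}_2=\{v>0\}.$$ Moreover, if $N\ge3$, then $u$ and $v$ can be constructed with $\alpha_1=\alpha_2$.
   Context: A function $w$ on $\mathbb{R}^N$ is homogeneous of degree $\alpha$ if $w(tx)=t^\alpha w(x)$ for all $t>0$ and $x\in\mathbb{R}^N$. A cone is a set $\mathcal{C}$ with $tx\in\mathcal{C}$ for all $x\in\mathcal{C}$, $t>0$. *)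

theory Defs
  imports "HOL-Analysis.Analysis"
begin

section \<open>Cones, homogeneous functions, matrices\<close>

text \<open>Unlike the library's \<^const>\<open>cone\<close>, only dilations by \<open>t > 0\<close> are required, so that an
  open cone need not contain the origin.\<close>

definition dilation_cone :: "(real^'n) set \<Rightarrow> bool" where
  "dilation_cone C \<longleftrightarrow> (\<forall>x\<in>C. \<forall>t>0. t *\<^sub>R x \<in> C)"

definition homogeneous_of_degree :: "real \<Rightarrow> (real^'n \<Rightarrow> real) \<Rightarrow> bool" where
  "homogeneous_of_degree \<alpha> w \<longleftrightarrow> (\<forall>t>0. \<forall>x. w (t *\<^sub>R x) = t powr \<alpha> * w x)"

definition diagonal_matrix :: "real^'n^'n \<Rightarrow> bool" where
  "diagonal_matrix A \<longleftrightarrow> (\<forall>i j. i \<noteq> j \<longrightarrow> A $ i $ j = 0)"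

definition positive_definite :: "real^'n^'n \<Rightarrow> bool" where
  "positive_definite A \<longleftrightarrow> transpose A = A \<and> (\<forall>x. x \<noteq> 0 \<longrightarrow> x \<bullet> (A *v x) > 0)"

section \<open>Test functions\<close>

definition partial_deriv :: "'n \<Rightarrow> (real^'n \<Rightarrow> real) \<Rightarrow> real^'n \<Rightarrow> real" where
  "partial_deriv i \<phi> x = frechet_derivative \<phi> (at x) (axis i 1)"

definition grad :: "(real^'n \<Rightarrow> real) \<Rightarrow> real^'n \<Rightarrow> real^'n" where
  "grad \<phi> x = (\<chi> i. partial_deriv i \<phi> x)"

primrec Ck :: "nat \<Rightarrow> (real^'n \<Rightarrow> real) \<Rightarrow> bool" where
  "Ck 0 \<phi> \<longleftrightarrow> continuous_on UNIV \<phi>"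
| "Ck (Suc k) \<phi> \<longleftrightarrow> (\<forall>x. \<phi> differentiable (at x)) \<and> (\<forall>i. Ck k (partial_deriv i \<phi>))"

text \<open>The space \<open>C\<^sub>c\<^sup>\<infinity>(U)\<close>, its elements being extended by zero to the whole space.\<close>

definition test_function :: "(real^'n) set \<Rightarrow> (real^'n \<Rightarrow> real) \<Rightarrow> bool" where
  "test_function U \<phi> \<longleftrightarrow> (\<forall>k. Ck k \<phi>) \<and>
     compact (closure {x. \<phi> x \<noteq> 0}) \<and> closure {x. \<phi> x \<noteq> 0} \<subseteq> U"

section \<open>Weak gradients and \<open>H\<^sup>1\<^sub>l\<^sub>o\<^sub>c\<close>\<close>

definition L1_loc :: "(real^'n \<Rightarrow> 'b::euclidean_space) \<Rightarrow> bool" where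
  "L1_loc f \<longleftrightarrow> (\<forall>K. compact K \<longrightarrow> set_integrable lebesgue K f)"

definition L2_loc :: "(real^'n \<Rightarrow> 'b::euclidean_space) \<Rightarrow> bool" where
  "L2_loc f \<longleftrightarrow> f \<in> borel_measurable lebesgue \<and>
     (\<forall>K. compact K \<longrightarrow> set_integrable lebesgue K (\<lambda>x. (norm (f x))\<^sup>2))"

text \<open>\<open>G\<close> is a distributional gradient of \<open>u\<close> on the whole space; it is unique up to null sets.\<close>

definition has_weak_gradient :: "(real^'n \<Rightarrow> real) \<Rightarrow> (real^'n \<Rightarrow> real^'n) \<Rightarrow> bool" where
  "has_weak_gradient u G \<longleftrightarrow> L1_loc u \<and> L1_loc G \<and>
     (\<forall>\<phi>. test_function UNIV \<phi> \<longrightarrow> (\<forall>i.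
        (LINT x|lebesgue. u x * partial_deriv i \<phi> x) = - (LINT x|lebesgue. G x $ i * \<phi> x)))"

definition H1_loc :: "(real^'n \<Rightarrow> real) \<Rightarrow> bool" where
  "H1_loc u \<longleftrightarrow> L2_loc u \<and> (\<exists>G. has_weak_gradient u G \<and> L2_loc G)"

section \<open>The equations\<close>

text \<open>\<open>div F = 0\<close> in the open set \<open>U\<close>, in the sense of distributions.\<close>

definition div_zero_in :: "(real^'n) set \<Rightarrow> (real^'n \<Rightarrow> real^'n) \<Rightarrow> bool" where
  "div_zero_in U F \<longleftrightarrow> (\<forall>\<phi>. test_function U \<phi> \<longrightarrow> (LINT x|lebesgue. F x \<bullet> grad \<phi> x) = 0)"

definition div_A_grad_zero_in :: "(real^'n) set \<Rightarrow> real^'n^'n \<Rightarrow> (real^'n \<Rightarrow> real) \<Rightarrow> bool" where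
  "div_A_grad_zero_in U A u \<longleftrightarrow>
     (\<exists>G. has_weak_gradient u G \<and> div_zero_in U (\<lambda>x. A *v G x))"

definition laplacian_zero_in :: "(real^'n) set \<Rightarrow> (real^'n \<Rightarrow> real) \<Rightarrow> bool" where
  "laplacian_zero_in U v \<longleftrightarrow> (\<exists>G. has_weak_gradient v G \<and> div_zero_in U G)"

section \<open>The configurations to be constructed\<close>

definition segregated_configuration ::
  "real^'n^'n \<Rightarrow> (real^'n) set \<Rightarrow> (real^'n) set \<Rightarrow> (real^'n \<Rightarrow> real) \<Rightarrow> (real^'n \<Rightarrow> real) \<Rightarrow>
   real \<Rightarrow> real \<Rightarrow> bool" where
  "segregated_configuration A C1 C2 u v \<alpha>1 \<alpha>2 \<longleftrightarrow>
     diagonal_matrix A \<and> positive_definite A \<and>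
     open C1 \<and> dilation_cone C1 \<and> open C2 \<and> dilation_cone C2 \<and> C1 \<inter> C2 = {} \<and>
     (\<forall>x. 0 \<le> u x) \<and> (\<exists>x. u x \<noteq> 0) \<and> (\<forall>x. 0 \<le> v x) \<and> (\<exists>x. v x \<noteq> 0) \<and>
     H1_loc u \<and> continuous_on UNIV u \<and> H1_loc v \<and> continuous_on UNIV v \<and>
     0 < \<alpha>1 \<and> homogeneous_of_degree \<alpha>1 u \<and> 0 < \<alpha>2 \<and> homogeneous_of_degree \<alpha>2 v \<and>
     \<alpha>1 + \<alpha>2 < 2 \<and>
     C1 = {x. 0 < u x} \<and> div_A_grad_zero_in C1 A u \<and>
     C2 = {x. 0 < v x} \<and> laplacian_zero_in C2 v"

end

theory Submission
  imports Defs
begin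

text \<open>
  By the Friedland--Hayman phenomenon, two disjoint cones carrying positive harmonic functions of
  degrees \<open>\<alpha>\<^sub>1\<close> and \<open>\<alpha>\<^sub>2\<close> satisfy \<open>\<alpha>\<^sub>1 + \<alpha>\<^sub>2 \<ge> 2\<close> when both equations are governed by the Laplacian.
  A diagonal matrix \<open>A\<close> removes the obstruction: a solution of \<open>div (A \<nabla>u) = 0\<close> is a harmonic
  function composed with an anisotropic dilation, and such a dilation can squeeze a large cone
  into a small one without changing the degree.

  In the plane, \<open>Re (\<zeta>\<^sup>\<alpha>)\<close> is positive on a sector of opening \<open>\<pi>/\<alpha>\<close>. For \<open>v\<close> take \<open>\<alpha> = 2/3\<close>
  and a sector of opening \<open>3\<pi>/2\<close>. Its complement is a quarter plane, into which a compression of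
  one variable fits the sector of opening \<open>4\<pi>/5\<close> that belongs to \<open>\<alpha> = 5/4\<close>, and
  \<open>2/3 + 5/4 < 2\<close>. In higher dimension the functions are constant in the remaining variables.

  Equal degrees have to be less than \<open>1\<close>, so that neither cone fits into a half-space. A dilation
  does not change this, and the cones must interlock like the two pieces of the cover of a tennis
  ball. Let \<open>\<zeta> = r exp (i\<phi>)\<close> be a complex coordinate on a plane of \<open>\<real>\<^sup>3\<close> and \<open>z\<close> the coordinate on its axis.
  Off the half-plane \<open>\<phi> = \<pi>\<close> the function
    \<open>Re (\<zeta>\<^sup>a) + \<epsilon> Re (\<zeta>\<^sup>-\<^sup>1\<^sup>/\<^sup>2) Re ((r + i z)\<^sup>a\<^sup>+\<^sup>1\<^sup>/\<^sup>2)\<close>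
  is harmonic and homogeneous of degree \<open>a\<close>. It equals \<open>r\<^sup>a\<close> times
  \<open>cos (a\<phi>) + \<epsilon> cos (\<phi>/2) h (z/r)\<close>, where \<open>h \<le> 1\<close> decreases from \<open>h 0 = 1\<close> to \<open>-\<infinity>\<close>. Hence the
  set where it is positive lies in a thick strip around an arc of longitudes,
  \<open>\<bar>\<phi>\<bar> < \<pi>/2 + \<mu>\<close> and \<open>\<bar>z\<bar> < \<tau> r\<close>, away from the half-plane and from the axis
  (lemma \<open>profile_support\<close>). For \<open>a\<close> close to \<open>1\<close> one can choose \<open>\<mu>\<close> small and
  \<open>\<tau> < cot \<mu>\<close> (lemma \<open>exists_narrow_profile\<close>). The functions \<open>v\<close> and \<open>u\<close> both come from this one
  profile, which explains why their degrees agree. They are placed so that the two arcs lie in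
  perpendicular planes and face opposite directions. Compressing the strip of \<open>u\<close> onto its plane
  makes it disjoint from the strip of \<open>v\<close> precisely because \<open>\<tau> < cot \<mu>\<close>: the ends of the flattened
  arc of \<open>u\<close> stay inside the hole of the strip of \<open>v\<close> around its axis
  (lemma \<open>crossed_cones_disjoint\<close>).

  Regularity is a general fact about a continuous function \<open>u \<ge> 0\<close> that solves
  \<open>\<Sum> a\<^sub>i \<partial>\<^sub>i\<^sub>i u = 0\<close> classically where it is positive (locale \<open>positive_solution\<close>). With
  convex \<open>C\<^sup>2\<close> truncations \<open>\<Theta>\<close> of the square that vanish near \<open>0\<close>, the function \<open>\<Theta> \<circ> u\<close> is twice
  differentiable everywhere, and \<open>\<Sum> a\<^sub>i \<partial>\<^sub>i\<^sub>i (\<Theta> \<circ> u) = \<Theta>'' (u) \<Sum> a\<^sub>i (\<partial>\<^sub>i u)\<^sup>2\<close>. Testing with a cutoff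
  bounds the energy of \<open>u\<close> without any information on the free boundary or on the vertex of the
  cone, and letting the truncation tend to the square identifies the weak gradient.
\<close>

section \<open>Integration by parts\<close>

lemma integrable_continuous_compact_support:
  fixes f :: "'a::euclidean_space \<Rightarrow> real"
  assumes "continuous_on UNIV f" "compact K" "\<And>x. x \<notin> K \<Longrightarrow> f x = 0"
  shows "integrable lborel f"
proof -
  have "integrable lborel (\<lambda>x. indicator K x *\<^sub>R f x)"
    using assms by (intro borel_integrable_compact) (auto intro: continuous_on_subset)
  also have "(\<lambda>x. indicator K x *\<^sub>R f x) = f"
    using assms(3) by (auto simp: indicator_def fun_eq_iff)
  finally show ?thesis .
qed

text \<open>The difference quotients of \<open>g\<close> in direction \<open>e\<close> integrate to zero because Lebesgue measure is
  translation invariant. They are bounded by the mean value theorem and live on a common ball, so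
  the limit may be taken under the integral.\<close>

lemma integral_compactly_supported_derivative:
  fixes g g' :: "'a::euclidean_space \<Rightarrow> real"
  assumes der: "\<And>x. ((\<lambda>t. g (x + t *\<^sub>R e)) has_real_derivative g' x) (at 0)"
    and cg: "continuous_on UNIV g" and cg': "continuous_on UNIV g'"
    and K: "compact K" "\<And>x. x \<notin> K \<Longrightarrow> g x = 0"
  shows "integral\<^sup>L lborel g' = 0"
proof -
  obtain R where R: "K \<subseteq> cball 0 R" "R \<ge> 0"
    using compact_imp_bounded[OF K(1)] unfolding bounded_iff subset_iff mem_cball_0
    by (metis abs_ge_zero linorder_linear order_trans)
  \<comment> \<open>A step \<open>h *\<^sub>R e\<close> with \<open>0 \<le> h \<le> 1\<close> reaches \<open>K\<close> only from \<open>S\<close>, and from \<open>S\<close> it stays in the ball of radius \<open>R + 2 * norm e\<close>.\<close>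
  define S where "S = cball (0::'a) (R + norm e)"
  have "bounded (g' ` cball 0 (R + 2 * norm e))"
    by (intro compact_imp_bounded compact_continuous_image continuous_on_subset[OF cg']) auto
  then obtain M where "\<forall>x\<in>cball 0 (R + 2 * norm e). \<bar>g' x\<bar> \<le> M"
    unfolding bounded_iff by auto
  then have M: "\<And>x. norm x \<le> R + 2 * norm e \<Longrightarrow> \<bar>g' x\<bar> \<le> M"
    by auto
  have int_g: "integrable lborel g" 
    using cg K by (rule integrable_continuous_compact_support)
  define h where "h n = 1 / real (Suc n)" for n
  have h: "h n > 0" "h n \<le> 1" for n by (auto simp: h_def)
  have h0: "h \<longlonglongrightarrow> 0"
    unfolding h_def using LIMSEQ_inverse_real_of_nat by (simp add: inverse_eq_divide)
  define q where "q n x = (g (x + h n *\<^sub>R e) - g x) / h n" for n x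
  have bg [measurable]: "g \<in> borel_measurable borel" "g' \<in> borel_measurable borel"
    using cg cg' by (auto intro: borel_measurable_continuous_onI)
  have q0: "integral\<^sup>L lborel (q n) = 0" for n
  proof -
    have tr: "integrable lborel (\<lambda>x. g (c + x))" "integral\<^sup>L lborel (\<lambda>x. g (c + x)) = integral\<^sup>L lborel g" for c
    proof -
      have "integrable (distr lborel borel ((+) c)) g" 
        using int_g by (simp add: lborel_distr_plus)
      then show "integrable lborel (\<lambda>x. g (c + x))"
        by (subst (asm) integrable_distr_eq) auto
      have "integral\<^sup>L lborel g = integral\<^sup>L (distr lborel borel ((+) c)) g" 
        by (simp add: lborel_distr_plus)
      then show "integral\<^sup>L lborel (\<lambda>x. g (c + x)) = integral\<^sup>L lborel g"
        by (subst (asm) integral_distr) auto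
    qed
    have "integrable lborel (\<lambda>x. g (x + h n *\<^sub>R e))"
      "integral\<^sup>L lborel (\<lambda>x. g (x + h n *\<^sub>R e)) = integral\<^sup>L lborel g"
      using tr[of "h n *\<^sub>R e"] by (simp_all add: add.commute)
    moreover have "q n = (\<lambda>x. (g (x + h n *\<^sub>R e) - g x) / h n)" by (auto simp: q_def)
    ultimately show ?thesis using int_g by simp
  qed
  have "(\<lambda>n. integral\<^sup>L lborel (q n)) \<longlonglongrightarrow> integral\<^sup>L lborel g'"
  proof (rule integral_dominated_convergence[where w = "\<lambda>x. indicator S x *\<^sub>R M"])
    show "g' \<in> borel_measurable lborel" by simp
    show "q n \<in> borel_measurable lborel" for n unfolding q_def by simp
    show "integrable lborel (\<lambda>x. indicator S x *\<^sub>R M)"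
      by (rule borel_integrable_compact) (auto simp: S_def)
    show "AE x in lborel. (\<lambda>i. q i x) \<longlonglongrightarrow> g' x"
    proof (rule AE_I2)
      fix x
      have "((\<lambda>t. (g (x + t *\<^sub>R e) - g x) / t) \<longlongrightarrow> g' x) (at 0)"
        using der[of x] by (simp add: has_field_derivative_iff)
      moreover have "filterlim h (at 0) sequentially"
        using h0 h(1) by (auto simp: filterlim_at less_imp_neq intro!: always_eventually) (metis less_irrefl)
      ultimately show "(\<lambda>i. q i x) \<longlonglongrightarrow> g' x"
        unfolding q_def by (rule filterlim_compose)
    qed
    show "AE x in lborel. norm (q n x) \<le> indicator S x *\<^sub>R M" for n
    proof (rule AE_I2)
      fix x
      show "norm (q n x) \<le> indicator S x *\<^sub>R M"
      proof (cases "x \<in> S")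
        case False
        then have nx: "norm x > R + norm e" by (auto simp: S_def)
        have "norm (x + h n *\<^sub>R e) \<ge> norm x - h n * norm e" 
          using norm_triangle_ineq4[of "x + h n *\<^sub>R e" "h n *\<^sub>R e"] h(1)[of n] by simp
        moreover have "h n * norm e \<le> norm e" using h[of n] by (simp add: mult_left_le_one_le)
        ultimately have "norm (x + h n *\<^sub>R e) > R" using nx by linarith
        moreover have "norm x > R" using nx norm_ge_zero[of e] by linarith
        ultimately have "x + h n *\<^sub>R e \<notin> K" "x \<notin> K" 
          using R(1) by (auto simp only: subset_iff mem_cball_0)
        then show ?thesis using K(2) False by (simp add: q_def)
      next
        case True
        have dt: "((\<lambda>t. g (x + t *\<^sub>R e)) has_real_derivative g' (x + t *\<^sub>R e)) (at t)" for t
        proof -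
          have "((\<lambda>s. g (x + t *\<^sub>R e + s *\<^sub>R e)) has_real_derivative g' (x + t *\<^sub>R e)) (at 0)"
            by (rule der)
          then show ?thesis
            using DERIV_shift[of "\<lambda>t. g (x + t *\<^sub>R e)" _ 0 t] by (simp add: algebra_simps)
        qed
        obtain s where s: "0 < s" "s < h n" "g (x + h n *\<^sub>R e) - g (x + 0 *\<^sub>R e) = (h n - 0) * g' (x + s *\<^sub>R e)"
          using MVT2[OF h(1), of n "\<lambda>t. g (x + t *\<^sub>R e)" "\<lambda>t. g' (x + t *\<^sub>R e)"] dt by blast
        have "q n x = g' (x + s *\<^sub>R e)" using s h[of n] by (simp add: q_def)
        moreover have "norm (x + s *\<^sub>R e) \<le> R + 2 * norm e"
        proof -
          have "norm (x + s *\<^sub>R e) \<le> norm x + s * norm e"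
            using norm_triangle_ineq[of x "s *\<^sub>R e"] s by simp
          moreover have "s * norm e \<le> norm e" using s h[of n] by (simp add: mult_left_le_one_le)
          ultimately show ?thesis using True by (simp add: S_def)
        qed
        ultimately show ?thesis using M True by simp
      qed
    qed
  qed
  then show ?thesis by (simp add: q0 LIMSEQ_const_iff)
qed

lemma integration_by_parts_compact_support:
  fixes f f' g g' :: "'a::euclidean_space \<Rightarrow> real"
  assumes f: "\<And>x. ((\<lambda>t. f (x + t *\<^sub>R e)) has_real_derivative f' x) (at 0)"
    and g: "\<And>x. ((\<lambda>t. g (x + t *\<^sub>R e)) has_real_derivative g' x) (at 0)"
    and c: "continuous_on UNIV f" "continuous_on UNIV f'" "continuous_on UNIV g" "continuous_on UNIV g'"
    and K: "compact K" "\<And>x. x \<notin> K \<Longrightarrow> g x = 0" "\<And>x. x \<notin> K \<Longrightarrow> g' x = 0"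
  shows "(LINT x|lborel. f' x * g x) = - (LINT x|lborel. f x * g' x)"
proof -
  have "integral\<^sup>L lborel (\<lambda>x. f' x * g x + f x * g' x) = 0"
  proof (rule integral_compactly_supported_derivative[where g = "\<lambda>x. f x * g x" and e = e and K = K])
    show "((\<lambda>t. f (x + t *\<^sub>R e) * g (x + t *\<^sub>R e)) has_real_derivative f' x * g x + f x * g' x) (at 0)" for x
      using DERIV_mult[OF f[of x] g[of x]] by (simp add: algebra_simps)
  qed (use c K in \<open>auto intro!: continuous_intros\<close>)
  moreover have "integrable lborel (\<lambda>x. f' x * g x)" "integrable lborel (\<lambda>x. f x * g' x)"
    using c K by (auto intro!: integrable_continuous_compact_support[OF _ K(1)] continuous_intros)
  ultimately show ?thesis by simp
qed

lemma integrable_lebesgue_lborel: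
  fixes f :: "'a::euclidean_space \<Rightarrow> 'b::euclidean_space"
  assumes "f \<in> borel_measurable borel"
  shows "integrable lebesgue f \<longleftrightarrow> integrable lborel f"
    "integral\<^sup>L lebesgue f = integral\<^sup>L lborel f"
  using assms by (auto intro!: integrable_completion integral_completion)

lemma continuous_on_split_cover:
  fixes f :: "'a::topological_space \<Rightarrow> 'b::topological_space"
  assumes "open S" "open T" "continuous_on S f" "continuous_on T f" "S \<union> T = UNIV"
  shows "continuous_on UNIV f"
  using continuous_on_open_Un[OF assms(1-4)] assms(5) by simp

lemma DERIV_locally_zero:
  assumes "eventually (\<lambda>t. f t = (0::real)) (nhds x)"
  shows "(f has_real_derivative 0) (at x)"
  using assms by (subst DERIV_cong_ev[OF refl _ refl, where g = "\<lambda>_. 0"]) auto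

lemma eventually_along_line:
  fixes x e :: "'a::real_normed_vector"
  assumes "open S" "x \<in> S"
  shows "eventually (\<lambda>t::real. x + t *\<^sub>R e \<in> S) (nhds 0)"
proof -
  have "open ((\<lambda>t::real. x + t *\<^sub>R e) -` S)"
    by (intro open_vimage assms(1) continuous_intros)
  moreover have "(0::real) \<in> (\<lambda>t::real. x + t *\<^sub>R e) -` S" using assms(2) by simp
  ultimately show ?thesis unfolding eventually_nhds by (intro exI[of _ "(\<lambda>t::real. x + t *\<^sub>R e) -` S"]) simp
qed

text \<open>Only one partial derivative at a time enters the integrations by parts, so a test function is
  used through its restrictions to lines parallel to the axes.\<close>

lemma test_function_facts:
  fixes \<phi> :: "real^'n \<Rightarrow> real"
  assumes "test_function U \<phi>"
  shows "continuous_on UNIV \<phi>" "continuous_on UNIV (partial_deriv i \<phi>)"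
    "((\<lambda>t. \<phi> (x + t *\<^sub>R axis i 1)) has_real_derivative partial_deriv i \<phi> x) (at 0)"
    "compact (closure {x. \<phi> x \<noteq> 0})" "closure {x. \<phi> x \<noteq> 0} \<subseteq> U"
    "x \<notin> closure {x. \<phi> x \<noteq> 0} \<Longrightarrow> \<phi> x = 0"
    "x \<notin> closure {x. \<phi> x \<noteq> 0} \<Longrightarrow> partial_deriv i \<phi> x = 0"
proof -
  have C: "Ck 1 \<phi>" using assms by (simp add: test_function_def)
  then have d: "\<phi> differentiable (at x)" for x by simp
  show "continuous_on UNIV \<phi>"
    using d by (auto intro!: continuous_at_imp_continuous_on differentiable_imp_continuous_within)
  show "continuous_on UNIV (partial_deriv i \<phi>)" using C by simp
  have der: "((\<lambda>t. \<phi> (x + t *\<^sub>R axis i 1)) has_real_derivative partial_deriv i \<phi> x) (at 0)" for x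
  proof -
    let ?D = "frechet_derivative \<phi> (at x)"
    have D: "(\<phi> has_derivative ?D) (at x)" using d[of x] by (simp only: frechet_derivative_works)
    then have lin: "linear ?D" by (rule has_derivative_linear)
    have "((\<lambda>t::real. x + t *\<^sub>R axis i 1) has_derivative (\<lambda>t. t *\<^sub>R axis i 1)) (at 0)"
      by (auto intro!: derivative_eq_intros)
    then have "((\<lambda>t. \<phi> (x + t *\<^sub>R axis i 1)) has_derivative (\<lambda>t. ?D (t *\<^sub>R axis i 1))) (at 0)"
      using has_derivative_compose[of "\<lambda>t::real. x + t *\<^sub>R axis i 1" _ 0 UNIV \<phi> ?D] D by simp
    moreover have "(\<lambda>t. ?D (t *\<^sub>R axis i 1)) = (*) (partial_deriv i \<phi> x)"
      using lin by (auto simp: linear_cmul partial_deriv_def mult.commute)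
    ultimately show ?thesis by (simp add: has_field_derivative_def)
  qed
  show "((\<lambda>t. \<phi> (x + t *\<^sub>R axis i 1)) has_real_derivative partial_deriv i \<phi> x) (at 0)" by (rule der)
  show "compact (closure {x. \<phi> x \<noteq> 0})" "closure {x. \<phi> x \<noteq> 0} \<subseteq> U"
    using assms by (auto simp: test_function_def)
  show zero: "\<phi> x = 0" if "x \<notin> closure {x. \<phi> x \<noteq> 0}" for x using that closure_subset[of "{x. \<phi> x \<noteq> 0}"] by auto
  show "partial_deriv i \<phi> x = 0" if x: "x \<notin> closure {x. \<phi> x \<noteq> 0}"
  proof -
    have "open (- closure {x. \<phi> x \<noteq> 0})" by auto
    have "eventually (\<lambda>t. x + t *\<^sub>R axis i 1 \<in> - closure {x. \<phi> x \<noteq> 0}) (nhds 0)"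
      by (rule eventually_along_line[OF \<open>open _\<close> ComplI]) (rule notE[OF x])
    then have "eventually (\<lambda>t. \<phi> (x + t *\<^sub>R axis i 1) = 0) (nhds 0)"
      by (rule eventually_mono) (rule zero, rule ComplD)
    then have "((\<lambda>t. \<phi> (x + t *\<^sub>R axis i 1)) has_real_derivative 0) (at 0)"
      by (rule DERIV_locally_zero)
    with der show ?thesis by (rule DERIV_unique)
  qed
qed

section \<open>A smooth truncation of the square\<close>

lemma DERIV_positive_part_power:
  "((\<lambda>y::real. max 0 y ^ Suc (Suc n)) has_real_derivative real (Suc (Suc n)) * max 0 y ^ Suc n) (at y)"
proof -
  consider "y > 0" | "y < 0" | "y = 0" by linarith
  then show ?thesis
  proof cases
    case 1
    have "((\<lambda>y::real. y ^ Suc (Suc n)) has_real_derivative real (Suc (Suc n)) * y ^ Suc n) (at y)"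
      by (rule derivative_eq_intros | simp)+
    moreover have "eventually (\<lambda>y. y > 0) (nhds y)" using 1 by (rule order_tendstoD[OF filterlim_ident])
    then have "eventually (\<lambda>y. y ^ Suc (Suc n) = max 0 y ^ Suc (Suc n)) (nhds y)"
      by eventually_elim simp
    ultimately show ?thesis using 1 by (simp add: DERIV_cong_ev)
  next
    case 2
    have "eventually (\<lambda>y. y < 0) (nhds y)" using 2 by (rule order_tendstoD[OF filterlim_ident])
    then have "eventually (\<lambda>y. max 0 y ^ Suc (Suc n) = 0) (nhds y)" by eventually_elim simp
    then have "((\<lambda>y. max 0 y ^ Suc (Suc n)) has_real_derivative 0) (at y) \<longleftrightarrow> ((\<lambda>y. 0::real) has_real_derivative 0) (at y)"
      by (intro DERIV_cong_ev) auto
    then show ?thesis using 2 by simp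
  next
    case 3
    have "((\<lambda>h::real. max 0 h ^ Suc (Suc n) / h) \<longlongrightarrow> 0) (at 0)"
    proof (rule Lim_null_comparison)
      show "((\<lambda>h::real. \<bar>h\<bar> ^ Suc n) \<longlongrightarrow> 0) (at 0)"
        by (rule tendsto_eq_intros | simp)+
      show "\<forall>\<^sub>F h::real in at 0. norm (max 0 h ^ Suc (Suc n) / h) \<le> \<bar>h\<bar> ^ Suc n"
        by (rule always_eventually) (auto simp: max_def abs_mult power_abs mult_nonpos_nonneg)
    qed
    then show ?thesis using 3 by (simp add: has_field_derivative_iff)
  qed
qed

text \<open>The factor by which positive numbers are damped in the truncations below. As a quotient by zero
  is zero, it also vanishes at \<open>t = 0\<close>.\<close>

definition trunc_ratio :: "real \<Rightarrow> real \<Rightarrow> real" where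
  "trunc_ratio \<epsilon> t = max 0 (t - \<epsilon>) / t"

text \<open>For \<open>t > \<epsilon>\<close> this is \<open>(t - \<epsilon>)\<^sup>3 / t\<close>. The third power makes the function twice continuously
  differentiable, and the division by \<open>t\<close> restores quadratic growth, so that the second
  derivative increases to \<open>2\<close> as \<open>\<epsilon>\<close> tends to \<open>0\<close>. The next two definitions are its derivatives
  in terms of the damping factor \<open>q\<close>, which satisfies \<open>t q' = 1 - q\<close> on \<open>t > \<epsilon>\<close>.\<close>

definition trunc_sq :: "real \<Rightarrow> real \<Rightarrow> real" where
  "trunc_sq \<epsilon> t = t\<^sup>2 * trunc_ratio \<epsilon> t ^ 3"

definition trunc_sq' :: "real \<Rightarrow> real \<Rightarrow> real" where
  "trunc_sq' \<epsilon> t = t * (3 * (trunc_ratio \<epsilon> t)\<^sup>2 - trunc_ratio \<epsilon> t ^ 3)"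

definition trunc_sq'' :: "real \<Rightarrow> real \<Rightarrow> real" where
  "trunc_sq'' \<epsilon> t = 2 * (1 - (1 - trunc_ratio \<epsilon> t) ^ 3)"

lemma trunc_ratio_zero: "t \<le> \<epsilon> \<Longrightarrow> trunc_ratio \<epsilon> t = 0"
  by (simp add: trunc_ratio_def)

lemma trunc_ratio_bounds: "\<epsilon> > 0 \<Longrightarrow> 0 \<le> trunc_ratio \<epsilon> t \<and> trunc_ratio \<epsilon> t \<le> 1"
  by (auto simp: trunc_ratio_def max_def divide_simps)

lemma trunc_sq_zero: "t \<le> \<epsilon> \<Longrightarrow> trunc_sq \<epsilon> t = 0" "t \<le> \<epsilon> \<Longrightarrow> trunc_sq' \<epsilon> t = 0"
  "t \<le> \<epsilon> \<Longrightarrow> trunc_sq'' \<epsilon> t = 0"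
  by (simp_all add: trunc_sq_def trunc_sq'_def trunc_sq''_def trunc_ratio_zero)

lemma trunc_bounds:
  assumes "\<epsilon> > 0"
  shows "0 \<le> trunc_sq \<epsilon> t" "trunc_sq \<epsilon> t \<le> t\<^sup>2" "\<bar>trunc_sq' \<epsilon> t\<bar> \<le> 2 * \<bar>t\<bar>"
    "0 \<le> trunc_sq'' \<epsilon> t" "trunc_sq'' \<epsilon> t \<le> 2"
proof -
  define q where "q = trunc_ratio \<epsilon> t"
  have q: "0 \<le> q" "q \<le> 1" using trunc_ratio_bounds[OF assms] by (auto simp: q_def)
  have p: "0 \<le> q ^ 3" "q ^ 3 \<le> 1" "0 \<le> (1 - q) ^ 3" "(1 - q) ^ 3 \<le> 1"
    using q by (auto intro: power_le_one)
  show "0 \<le> trunc_sq \<epsilon> t" "trunc_sq \<epsilon> t \<le> t\<^sup>2"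
    using p by (auto simp: trunc_sq_def q_def[symmetric] mult_left_le)
  show "0 \<le> trunc_sq'' \<epsilon> t" "trunc_sq'' \<epsilon> t \<le> 2"
    using p by (auto simp: trunc_sq''_def q_def[symmetric])
  have "3 * q\<^sup>2 - q ^ 3 = q\<^sup>2 * (3 - q)" by (simp add: algebra_simps power2_eq_square power3_eq_cube)
  moreover have "0 \<le> q\<^sup>2 * (3 - q)" using q by simp
  moreover have "2 - (3 * q\<^sup>2 - q ^ 3) = (1 - q) * (2 + 2 * q - q\<^sup>2)"
    by (simp add: algebra_simps power2_eq_square power3_eq_cube)
  moreover have "q\<^sup>2 \<le> 1" using q by (simp add: power_le_one)
  then have "0 \<le> (1 - q) * (2 + 2 * q - q\<^sup>2)" using q by (intro mult_nonneg_nonneg) auto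
  ultimately have "\<bar>3 * q\<^sup>2 - q ^ 3\<bar> \<le> 2" by linarith
  then have "\<bar>t\<bar> * \<bar>3 * q\<^sup>2 - q ^ 3\<bar> \<le> \<bar>t\<bar> * 2" by (intro mult_left_mono) auto
  then show "\<bar>trunc_sq' \<epsilon> t\<bar> \<le> 2 * \<bar>t\<bar>"
    by (simp add: trunc_sq'_def q_def[symmetric] abs_mult)
qed

lemma DERIV_trunc:
  assumes "\<epsilon> > 0"
  shows "(trunc_sq \<epsilon> has_real_derivative trunc_sq' \<epsilon> t) (at t)"
    and "(trunc_sq' \<epsilon> has_real_derivative trunc_sq'' \<epsilon> t) (at t)"
proof -
  have "(trunc_sq \<epsilon> has_real_derivative trunc_sq' \<epsilon> t) (at t) \<and>
        (trunc_sq' \<epsilon> has_real_derivative trunc_sq'' \<epsilon> t) (at t)"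
  proof (cases "t < \<epsilon>")
    case True
    have ev: "eventually (\<lambda>t. t < \<epsilon>) (nhds t)" using True by (rule order_tendstoD[OF filterlim_ident])
    then have "eventually (\<lambda>t. trunc_sq \<epsilon> t = 0) (nhds t)" "eventually (\<lambda>t. trunc_sq' \<epsilon> t = 0) (nhds t)"
      by (eventually_elim; simp add: trunc_sq_zero)+
    then have "(trunc_sq \<epsilon> has_real_derivative 0) (at t)" "(trunc_sq' \<epsilon> has_real_derivative 0) (at t)"
      by (auto simp: DERIV_cong_ev)
    then show ?thesis using True by (simp add: trunc_sq_zero)
  next
    case False
    then have t: "t > 0" using assms by simp
    define m where "m t = max 0 (t - \<epsilon>)" for t
    have d3: "((\<lambda>t. m t ^ 3) has_real_derivative 3 * (m t)\<^sup>2) (at t)"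
    proof -
      have "((\<lambda>t. t - \<epsilon>) has_real_derivative 1) (at t)" by (auto intro!: derivative_eq_intros)
      from DERIV_chain2[where g = "\<lambda>t. t - \<epsilon>", OF DERIV_positive_part_power[of 1] this]
      show ?thesis unfolding m_def by (simp add: numeral_eq_Suc)
    qed
    have d2: "((\<lambda>t. (m t)\<^sup>2) has_real_derivative 2 * m t) (at t)"
    proof -
      have "((\<lambda>t. t - \<epsilon>) has_real_derivative 1) (at t)" by (auto intro!: derivative_eq_intros)
      from DERIV_chain2[where g = "\<lambda>t. t - \<epsilon>", OF DERIV_positive_part_power[of 0] this]
      show ?thesis unfolding m_def by (simp add: numeral_eq_Suc)
    qed
    have ev: "eventually (\<lambda>t. t > 0) (nhds t)" using t by (rule order_tendstoD[OF filterlim_ident])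
    define q where "q = trunc_ratio \<epsilon> t"
    have mt: "m t = q * t" using t by (simp add: q_def m_def trunc_ratio_def)
    have "((\<lambda>t. m t ^ 3 / t) has_real_derivative trunc_sq' \<epsilon> t) (at t)"
    proof (rule DERIV_cong[OF DERIV_divide[OF d3 DERIV_ident]])
      show "(3 * (m t)\<^sup>2 * t - m t ^ 3 * 1) / (t * t) = trunc_sq' \<epsilon> t" using t
        unfolding mt trunc_sq'_def q_def[symmetric]
        by (simp add: divide_simps) (simp add: algebra_simps power2_eq_square power3_eq_cube power4_eq_xxxx)
    qed (use t in auto)
    moreover have "((\<lambda>t. 3 * ((m t)\<^sup>2 / t) - m t ^ 3 / t\<^sup>2) has_real_derivative trunc_sq'' \<epsilon> t) (at t)"
    proof (rule DERIV_cong[OF DERIV_diff[OF DERIV_cmult[OF DERIV_divide[OF d2 DERIV_ident]]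
            DERIV_divide[OF d3 DERIV_pow[of 2]]]])
      show "3 * ((2 * m t * t - (m t)\<^sup>2 * 1) / (t * t)) -
          (3 * (m t)\<^sup>2 * t\<^sup>2 - m t ^ 3 * (real 2 * t ^ (2 - Suc 0))) / (t\<^sup>2 * t\<^sup>2) = trunc_sq'' \<epsilon> t"
        using t unfolding mt trunc_sq''_def q_def[symmetric]
        by (simp add: divide_simps) (simp add: algebra_simps power2_eq_square power3_eq_cube power4_eq_xxxx)
    qed (use t in auto)
    moreover have "eventually (\<lambda>t. m t ^ 3 / t = trunc_sq \<epsilon> t) (nhds t)"
      using ev by eventually_elim (simp add: trunc_sq_def trunc_ratio_def m_def field_simps power2_eq_square power3_eq_cube)
    moreover have "eventually (\<lambda>t. 3 * ((m t)\<^sup>2 / t) - m t ^ 3 / t\<^sup>2 = trunc_sq' \<epsilon> t) (nhds t)"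
      using ev by eventually_elim (simp add: trunc_sq'_def trunc_ratio_def m_def field_simps power2_eq_square power3_eq_cube)
    ultimately show ?thesis by (simp add: DERIV_cong_ev)
  qed
  then show "(trunc_sq \<epsilon> has_real_derivative trunc_sq' \<epsilon> t) (at t)"
    and "(trunc_sq' \<epsilon> has_real_derivative trunc_sq'' \<epsilon> t) (at t)" by auto
qed

lemma continuous_trunc:
  assumes "\<epsilon> > 0"
  shows "continuous_on UNIV (trunc_sq \<epsilon>)" "continuous_on UNIV (trunc_sq' \<epsilon>)" "continuous_on UNIV (trunc_sq'' \<epsilon>)"
proof -
  show "continuous_on UNIV (trunc_sq \<epsilon>)" "continuous_on UNIV (trunc_sq' \<epsilon>)"
    using DERIV_trunc[OF assms] by (auto intro!: continuous_at_imp_continuous_on DERIV_isCont)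
  have "isCont (trunc_sq'' \<epsilon>) t" for t
  proof (cases "t < \<epsilon>")
    case True
    have "eventually (\<lambda>t. t < \<epsilon>) (nhds t)" using True by (rule order_tendstoD[OF filterlim_ident])
    then have "eventually (\<lambda>t. trunc_sq'' \<epsilon> t = 0) (nhds t)"
      by (eventually_elim; simp add: trunc_sq_zero)+
    then show ?thesis by (subst isCont_cong) auto
  next
    case False
    then show ?thesis using assms unfolding trunc_sq''_def trunc_ratio_def
      by (auto intro!: continuous_intros)
  qed
  then show "continuous_on UNIV (trunc_sq'' \<epsilon>)" by (auto intro!: continuous_at_imp_continuous_on)
qed

lemma trunc_limits:
  assumes "t \<ge> 0"
  shows "(\<lambda>n. trunc_sq' (1 / Suc n) t) \<longlonglongrightarrow> 2 * t"
    and "t > 0 \<Longrightarrow> (\<lambda>n. trunc_sq'' (1 / Suc n) t) \<longlonglongrightarrow> 2"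
proof -
  have q: "(\<lambda>n. trunc_ratio (1 / Suc n) t) \<longlonglongrightarrow> 1" if "t > 0"
  proof -
    have "(\<lambda>n. 1 / real (Suc n)) \<longlonglongrightarrow> 0"
      using LIMSEQ_inverse_real_of_nat by (simp add: inverse_eq_divide)
    then have "(\<lambda>n. max 0 (t - 1 / real (Suc n)) / t) \<longlonglongrightarrow> max 0 (t - 0) / t"
      using that by (intro tendsto_intros) auto
    then show ?thesis using that by (simp add: trunc_ratio_def)
  qed
  show "(\<lambda>n. trunc_sq' (1 / Suc n) t) \<longlonglongrightarrow> 2 * t"
  proof (cases "t = 0")
    case False
    then have "t > 0" using assms by simp
    from q[OF this] show ?thesis unfolding trunc_sq'_def by (auto intro!: tendsto_eq_intros)
  qed (simp add: trunc_sq'_def)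
  show "(\<lambda>n. trunc_sq'' (1 / Suc n) t) \<longlonglongrightarrow> 2" if "t > 0"
    using q[OF that] unfolding trunc_sq''_def by (auto intro!: tendsto_eq_intros)
qed

section \<open>Regularity of positive solutions\<close>

text \<open>A polynomial bump on the ball of squared radius \<open>R\<close>. The third power makes it twice continuously
  differentiable, which is all that the energy estimate asks of a cutoff.\<close>

definition cutoff :: "real \<Rightarrow> real^'n \<Rightarrow> real" where
  "cutoff R x = max 0 (R - (norm x)\<^sup>2) ^ 3"

definition cutoff' :: "real \<Rightarrow> 'n \<Rightarrow> real^'n \<Rightarrow> real" where
  "cutoff' R i x = - 6 * x $ i * (max 0 (R - (norm x)\<^sup>2))\<^sup>2"

definition cutoff'' :: "real \<Rightarrow> 'n \<Rightarrow> real^'n \<Rightarrow> real" where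
  "cutoff'' R i x = - 6 * (max 0 (R - (norm x)\<^sup>2))\<^sup>2 + 24 * (x $ i)\<^sup>2 * max 0 (R - (norm x)\<^sup>2)"

lemma cutoff_facts:
  fixes x :: "real^'n"
  shows "continuous_on UNIV (cutoff R :: real^'n \<Rightarrow> real)" "continuous_on UNIV (cutoff' R i)" "continuous_on UNIV (cutoff'' R i)"
    "((\<lambda>t. cutoff R (x + t *\<^sub>R axis i 1)) has_real_derivative cutoff' R i x) (at 0)"
    "((\<lambda>t. cutoff' R i (x + t *\<^sub>R axis i 1)) has_real_derivative cutoff'' R i x) (at 0)"
    "cutoff R x \<ge> 0"
    "x \<notin> cball 0 (sqrt R) \<Longrightarrow> cutoff R x = 0 \<and> cutoff' R i x = 0 \<and> cutoff'' R i x = 0"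
proof -
  show "continuous_on UNIV (cutoff R :: real^'n \<Rightarrow> real)" "continuous_on UNIV (cutoff' R i)" "continuous_on UNIV (cutoff'' R i)"
    unfolding cutoff_def cutoff'_def cutoff''_def by (intro continuous_intros)+
  show "cutoff R x \<ge> 0" by (simp add: cutoff_def)
  show "x \<notin> cball 0 (sqrt R) \<Longrightarrow> cutoff R x = 0 \<and> cutoff' R i x = 0 \<and> cutoff'' R i x = 0"
  proof -
    assume "x \<notin> cball 0 (sqrt R)"
    then have "R \<le> (norm x)\<^sup>2" by (simp add: sqrt_le_D less_imp_le)
    then show ?thesis by (simp add: cutoff_def cutoff'_def cutoff''_def)
  qed
  let ?e = "axis i 1 :: real^'n"
  have nrm: "(norm (x + t *\<^sub>R ?e))\<^sup>2 = (norm x)\<^sup>2 + 2 * t * x $ i + t\<^sup>2" for t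
    using dot_norm[of x "t *\<^sub>R ?e"] by (simp add: inner_axis field_simps)
  have q: "((\<lambda>t. R - (norm (x + t *\<^sub>R ?e))\<^sup>2) has_real_derivative - 2 * x $ i) (at 0)"
    unfolding nrm by (auto intro!: derivative_eq_intros)
  define m where "m t = max 0 (R - (norm (x + t *\<^sub>R ?e))\<^sup>2)" for t
  have d: "((\<lambda>t. m t ^ Suc (Suc n)) has_real_derivative real (Suc (Suc n)) * m 0 ^ Suc n * (- 2 * x $ i)) (at 0)" for n
    using DERIV_chain2[where g = "\<lambda>t. R - (norm (x + t *\<^sub>R ?e))\<^sup>2", OF DERIV_positive_part_power[of n] q]
    by (simp add: m_def)
  show "((\<lambda>t. cutoff R (x + t *\<^sub>R ?e)) has_real_derivative cutoff' R i x) (at 0)"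
    using d[of 1] by (simp add: cutoff_def cutoff'_def m_def numeral_eq_Suc mult_ac)
  have l: "((\<lambda>t. - 6 * (x $ i + t)) has_real_derivative - 6) (at 0)"
    by (auto intro!: derivative_eq_intros)
  have "((\<lambda>t. (m t)\<^sup>2) has_real_derivative 2 * m 0 * (- 2 * x $ i)) (at 0)"
    using d[of 0] by (simp add: numeral_2_eq_2)
  from DERIV_mult[OF l this] have "((\<lambda>t. - 6 * (x $ i + t) * (m t)\<^sup>2) has_real_derivative
     - 6 * (m 0)\<^sup>2 + 24 * (x $ i)\<^sup>2 * m 0) (at 0)"
    by (simp add: power2_eq_square algebra_simps)
  then show "((\<lambda>t. cutoff' R i (x + t *\<^sub>R ?e)) has_real_derivative cutoff'' R i x) (at 0)"
    by (simp add: cutoff'_def cutoff''_def m_def)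
qed

text \<open>A continuous non-negative function that satisfies the equation classically where it is positive.
  Nothing is assumed at its zeros. Since the operator is diagonal, only the pure second derivatives
  \<open>D2 i\<close> occur.\<close>

locale positive_solution =
  fixes u :: "real^'n \<Rightarrow> real" and a :: "'n \<Rightarrow> real" and D D2 :: "'n \<Rightarrow> real^'n \<Rightarrow> real"
  assumes cont: "continuous_on UNIV u" and nonneg: "\<And>x. 0 \<le> u x"
    and a_pos: "\<And>i. 0 < a i"
    and D_der: "\<And>i x. 0 < u x \<Longrightarrow> ((\<lambda>t. u (x + t *\<^sub>R axis i 1)) has_real_derivative D i x) (at 0)"
    and D2_der: "\<And>i x. 0 < u x \<Longrightarrow> ((\<lambda>t. D i (x + t *\<^sub>R axis i 1)) has_real_derivative D2 i x) (at 0)"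
    and D_cont: "\<And>i. continuous_on {x. 0 < u x} (D i)"
    and D2_cont: "\<And>i. continuous_on {x. 0 < u x} (D2 i)"
    and eqn: "\<And>x. 0 < u x \<Longrightarrow> (\<Sum>i\<in>UNIV. a i * D2 i x) = 0"
begin

lemma open_pos: "open {x. 0 < u x}"
  using cont by (intro open_Collect_less) auto

text \<open>A factor that vanishes for \<open>u \<le> \<epsilon>\<close> hides the boundary of the positivity set: the open sets
  \<open>{u > 0}\<close> and \<open>{u < \<epsilon>}\<close> cover the space, and the product is zero on the second one. The same
  covering gives the derivative in the next lemma.\<close>

lemma continuous_truncated:
  fixes g :: "real \<Rightarrow> real" and E :: "real^'n \<Rightarrow> real"
  assumes "0 < \<epsilon>" "continuous_on UNIV g" "\<And>t. t \<le> \<epsilon> \<Longrightarrow> g t = 0" "continuous_on {x. 0 < u x} E"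
  shows "continuous_on UNIV (\<lambda>x. g (u x) * E x)"
proof (rule continuous_on_split_cover)
  show "open {x. 0 < u x}" by (rule open_pos)
  show "open {x. u x < \<epsilon>}" using cont by (intro open_Collect_less) auto
  show "continuous_on {x. 0 < u x} (\<lambda>x. g (u x) * E x)"
  proof (rule continuous_on_mult[OF _ assms(4)])
    show "continuous_on {x. 0 < u x} (\<lambda>x. g (u x))"
      by (rule continuous_on_compose2[OF assms(2) continuous_on_subset[OF cont]]) auto
  qed
  show "continuous_on {x. u x < \<epsilon>} (\<lambda>x. g (u x) * E x)"
    using assms(3) by (subst continuous_on_cong[OF refl, where g = "\<lambda>x. 0"]) auto
  show "{x. 0 < u x} \<union> {x. u x < \<epsilon>} = UNIV" using assms(1) by auto
qed

lemma DERIV_truncated: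
  assumes "0 < \<epsilon>" "\<And>t. (g has_real_derivative g' t) (at t)" "\<And>t. t \<le> \<epsilon> \<Longrightarrow> g t = 0 \<and> g' t = 0"
    "\<And>x. 0 < u x \<Longrightarrow> ((\<lambda>t. E (x + t *\<^sub>R axis i 1)) has_real_derivative E' x) (at 0)"
  shows "((\<lambda>t. g (u (x + t *\<^sub>R axis i 1)) * E (x + t *\<^sub>R axis i 1)) has_real_derivative
      g' (u x) * D i x * E x + g (u x) * E' x) (at 0)"
proof (cases "0 < u x")
  case True
  have "((\<lambda>t. g (u (x + t *\<^sub>R axis i 1))) has_real_derivative g' (u x) * D i x) (at 0)"
    using DERIV_chain2[where g = "\<lambda>t. u (x + t *\<^sub>R axis i 1)" and f = g and x = 0] assms(2) D_der[OF True] by simp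
  from DERIV_mult[OF this assms(4)[OF True]] show ?thesis by (simp add: algebra_simps)
next
  case False
  then have "x \<in> {x. u x < \<epsilon>}" using assms(1) by simp
  moreover have "open {x. u x < \<epsilon>}" using cont by (intro open_Collect_less) auto
  ultimately have "eventually (\<lambda>t. x + t *\<^sub>R axis i 1 \<in> {x. u x < \<epsilon>}) (nhds 0)"
    by (intro eventually_along_line)
  then have "eventually (\<lambda>t. g (u (x + t *\<^sub>R axis i 1)) * E (x + t *\<^sub>R axis i 1) = 0) (nhds 0)"
    by eventually_elim (simp add: assms(3))
  then have "((\<lambda>t. g (u (x + t *\<^sub>R axis i 1)) * E (x + t *\<^sub>R axis i 1)) has_real_derivative 0) (at 0)"
    by (rule DERIV_locally_zero)
  moreover have "g (u x) = 0" "g' (u x) = 0" using False assms(1,3) by auto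
  ultimately show ?thesis by simp
qed

text \<open>The Caccioppoli identity. Integrating by parts twice moves both derivatives of \<open>\<Theta> \<circ> u\<close> to the
  cutoff. In \<open>\<Sum> a\<^sub>i \<partial>\<^sub>i\<^sub>i (\<Theta> \<circ> u) = \<Theta>''(u) \<Sum> a\<^sub>i (\<partial>\<^sub>i u)\<^sup>2 + \<Theta>'(u) \<Sum> a\<^sub>i \<partial>\<^sub>i\<^sub>i u\<close> the last sum is
  zero by the equation.\<close>

lemma energy_identity:
  assumes \<epsilon>: "0 < \<epsilon>"
  shows "(LINT x|lborel. trunc_sq'' \<epsilon> (u x) * (\<Sum>i\<in>UNIV. a i * (D i x)\<^sup>2) * cutoff R x) =
         (LINT x|lborel. trunc_sq \<epsilon> (u x) * (\<Sum>i\<in>UNIV. a i * cutoff'' R i x))"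
proof -
  define V where "V i x = trunc_sq' \<epsilon> (u x) * D i x" for i x
  define W where "W i x = trunc_sq'' \<epsilon> (u x) * (D i x)\<^sup>2 + trunc_sq' \<epsilon> (u x) * D2 i x" for i x
  have cT: "continuous_on UNIV (\<lambda>x. trunc_sq \<epsilon> (u x))"
    by (rule continuous_on_compose2[OF continuous_trunc(1)[OF \<epsilon>] cont]) auto
  have cV: "continuous_on UNIV (V i)" for i
    unfolding V_def using continuous_trunc[OF \<epsilon>] D_cont
    by (intro continuous_truncated[OF \<epsilon>]) (auto simp: trunc_sq_zero)
  have cW: "continuous_on UNIV (W i)" for i
    unfolding W_def using continuous_trunc[OF \<epsilon>] D_cont D2_cont
    by (intro continuous_on_add continuous_truncated[OF \<epsilon>] continuous_intros) (auto simp: trunc_sq_zero)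
  have dT: "((\<lambda>t. trunc_sq \<epsilon> (u (x + t *\<^sub>R axis i 1))) has_real_derivative V i x) (at 0)" for i x
    using DERIV_truncated[OF \<epsilon> DERIV_trunc(1)[OF \<epsilon>], of "\<lambda>_. 1" i "\<lambda>_. 0" x]
    by (simp add: trunc_sq_zero V_def)
  have dV: "((\<lambda>t. V i (x + t *\<^sub>R axis i 1)) has_real_derivative W i x) (at 0)" for i x
    using DERIV_truncated[OF \<epsilon> DERIV_trunc(2)[OF \<epsilon>], of "D i" i "D2 i" x] D2_der
    by (simp add: trunc_sq_zero V_def W_def power2_eq_square mult_ac)
  note cc = cutoff_facts(1,2,3)
  have zero: "cutoff R x = 0" "cutoff' R i x = 0" "cutoff'' R i x = 0"
    if "x \<notin> cball 0 (sqrt R)" for x :: "real^'n" and i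
    using cutoff_facts(7)[OF that] by auto
  have int: "integrable lborel (\<lambda>x. f x * g x)"
    if "continuous_on UNIV f" "continuous_on UNIV g" "\<And>x. x \<notin> cball 0 (sqrt R) \<Longrightarrow> g x = 0" for f g :: "real^'n \<Rightarrow> real"
    using that by (intro integrable_continuous_compact_support[OF _ compact_cball[of 0 "sqrt R"]] continuous_intros) auto
  have ibp: "(LINT x|lborel. W i x * cutoff R x) = (LINT x|lborel. trunc_sq \<epsilon> (u x) * cutoff'' R i x)" for i
  proof -
    have "(LINT x|lborel. W i x * cutoff R x) = - (LINT x|lborel. V i x * cutoff' R i x)"
      by (rule integration_by_parts_compact_support[where e = "axis i 1" and K = "cball 0 (sqrt R)"])
        (rule dV cV cW cc cutoff_facts zero compact_cball | assumption)+
    moreover have "(LINT x|lborel. V i x * cutoff' R i x) = - (LINT x|lborel. trunc_sq \<epsilon> (u x) * cutoff'' R i x)"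
      by (rule integration_by_parts_compact_support[where e = "axis i 1" and K = "cball 0 (sqrt R)"])
        (rule dT cT cV cc cutoff_facts zero compact_cball | assumption)+
    ultimately show ?thesis by simp
  qed
  have "trunc_sq'' \<epsilon> (u x) * (\<Sum>i\<in>UNIV. a i * (D i x)\<^sup>2) * cutoff R x = (\<Sum>i\<in>UNIV. a i * (W i x * cutoff R x))" for x
  proof -
    define p q where "p = trunc_sq'' \<epsilon> (u x)" and "q = trunc_sq' \<epsilon> (u x)"
    have "a i * (W i x * cutoff R x) =
      (p * cutoff R x) * (a i * (D i x)\<^sup>2) + (q * cutoff R x) * (a i * D2 i x)" for i
      by (simp add: W_def p_def q_def algebra_simps)
    then have "(\<Sum>i\<in>UNIV. a i * (W i x * cutoff R x)) =
        (p * cutoff R x) * (\<Sum>i\<in>UNIV. a i * (D i x)\<^sup>2) + (q * cutoff R x) * (\<Sum>i\<in>UNIV. a i * D2 i x)"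
      by (simp only: sum.distrib sum_distrib_left)
    moreover have "q * cutoff R x * (\<Sum>i\<in>UNIV. a i * D2 i x) = 0"
      using eqn[of x] \<epsilon> by (cases "0 < u x") (auto simp: trunc_sq_zero q_def)
    ultimately show ?thesis by (simp add: p_def mult_ac)
  qed
  then have "(LINT x|lborel. trunc_sq'' \<epsilon> (u x) * (\<Sum>i\<in>UNIV. a i * (D i x)\<^sup>2) * cutoff R x) =
     (\<Sum>i\<in>UNIV. a i * (LINT x|lborel. W i x * cutoff R x))"
    using int[OF cW cc(1) zero(1)] by (simp add: Bochner_Integration.integral_sum)
  also have "\<dots> = (\<Sum>i\<in>UNIV. a i * (LINT x|lborel. trunc_sq \<epsilon> (u x) * cutoff'' R i x))"
    by (simp add: ibp)
  also have "\<dots> = (LINT x|lborel. (\<Sum>i\<in>UNIV. a i * (trunc_sq \<epsilon> (u x) * cutoff'' R i x)))"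
    using int[OF cT cc(3) zero(3)] by (simp add: Bochner_Integration.integral_sum)
  also have "(\<lambda>x. \<Sum>i\<in>UNIV. a i * (trunc_sq \<epsilon> (u x) * cutoff'' R i x)) =
      (\<lambda>x. trunc_sq \<epsilon> (u x) * (\<Sum>i\<in>UNIV. a i * cutoff'' R i x))"
    by (simp add: sum_distrib_left mult.left_commute)
  finally show ?thesis .
qed

definition extended_gradient :: "real^'n \<Rightarrow> real^'n" where
  "extended_gradient x = (\<chi> i. if 0 < u x then D i x else 0)"

definition energy :: "real^'n \<Rightarrow> real" where
  "energy x = (\<Sum>i\<in>UNIV. a i * (extended_gradient x $ i)\<^sup>2)"

lemma extended_gradient_borel [measurable]: "(\<lambda>x. extended_gradient x $ i) \<in> borel_measurable borel"
proof -
  have "(\<lambda>x. indicator {x. 0 < u x} x *\<^sub>R D i x) \<in> borel_measurable borel"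
    using D_cont open_pos by (intro borel_measurable_continuous_on_indicator) auto
  also have "(\<lambda>x. indicator {x. 0 < u x} x *\<^sub>R D i x) = (\<lambda>x. extended_gradient x $ i)"
    by (auto simp: extended_gradient_def indicator_def)
  finally show ?thesis .
qed

lemma u_borel [measurable]: "u \<in> borel_measurable borel"
  using cont by (rule borel_measurable_continuous_onI)

lemma energy_borel [measurable]: "energy \<in> borel_measurable borel"
  unfolding energy_def by simp

lemma energy_nonneg: "0 \<le> energy x"
  unfolding energy_def using a_pos by (intro sum_nonneg) (simp add: less_imp_le)

lemma cutoff_borel [measurable]: "cutoff R \<in> borel_measurable borel"
  by (rule borel_measurable_continuous_onI[OF cutoff_facts(1)])

lemma trunc_borel:
  assumes "\<epsilon> > 0"
  shows "(\<lambda>x. trunc_sq' \<epsilon> (u x)) \<in> borel_measurable borel"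
    "(\<lambda>x. trunc_sq'' \<epsilon> (u x)) \<in> borel_measurable borel"
proof -
  have "continuous_on UNIV (\<lambda>x. trunc_sq' \<epsilon> (u x))"
    by (rule continuous_on_compose2[OF continuous_trunc(2)[OF assms] cont]) auto
  then show "(\<lambda>x. trunc_sq' \<epsilon> (u x)) \<in> borel_measurable borel" by (rule borel_measurable_continuous_onI)
  have "continuous_on UNIV (\<lambda>x. trunc_sq'' \<epsilon> (u x))"
    by (rule continuous_on_compose2[OF continuous_trunc(3)[OF assms] cont]) auto
  then show "(\<lambda>x. trunc_sq'' \<epsilon> (u x)) \<in> borel_measurable borel" by (rule borel_measurable_continuous_onI)
qed

lemma trunc_sq''_energy:
  assumes "\<epsilon> > 0"
  shows "trunc_sq'' \<epsilon> (u x) * energy x = trunc_sq'' \<epsilon> (u x) * (\<Sum>i\<in>UNIV. a i * (D i x)\<^sup>2)"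
proof (cases "0 < u x")
  case True
  then show ?thesis by (simp add: energy_def extended_gradient_def)
next
  case False
  then show ?thesis using assms by (simp add: trunc_sq_zero)
qed

text \<open>The right-hand side of the energy identity is bounded independently of the truncation, since
  \<open>0 \<le> \<Theta> \<le> u\<^sup>2\<close>. The left-hand side converges pointwise to twice the energy density, and Fatou's
  lemma transfers the bound.\<close>

lemma energy_integrable: "integrable lborel (\<lambda>x. energy x * cutoff R x)"
proof -
  define C where "C = (LINT x|lborel. (u x)\<^sup>2 * \<bar>\<Sum>i\<in>UNIV. a i * cutoff'' R i x\<bar>)"
  define e where "e n = 1 / real (Suc n)" for n
  have e: "e n > 0" for n by (simp add: e_def)
  have off: "x \<notin> cball 0 (sqrt R) \<Longrightarrow> cutoff R x = 0 \<and> (\<forall>i. cutoff'' R i x = 0)" for x :: "real^'n"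
    using cutoff_facts(7) by blast
  define f where "f n x = trunc_sq'' (e n) (u x) * energy x * cutoff R x" for n x
  have f_borel [measurable]: "f n \<in> borel_measurable borel" for n
    unfolding f_def using trunc_borel(2)[OF e] by measurable
  have f_nonneg: "0 \<le> f n x" for n x
    unfolding f_def using trunc_bounds(4)[OF e] energy_nonneg cutoff_facts(6) by (intro mult_nonneg_nonneg)
  have f_eq: "f n = (\<lambda>x. trunc_sq'' (e n) (u x) * ((\<Sum>i\<in>UNIV. a i * (D i x)\<^sup>2) * cutoff R x))" for n
    unfolding f_def trunc_sq''_energy[OF e] by (simp add: mult.assoc)
  have f_int: "integrable lborel (f n)" for n
  proof (rule integrable_continuous_compact_support[OF _ compact_cball[of 0 "sqrt R"]])
    show "continuous_on UNIV (f n)" unfolding f_eq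
    proof (rule continuous_truncated[OF e continuous_trunc(3)[OF e]])
      show "continuous_on {x. 0 < u x} (\<lambda>x. (\<Sum>i\<in>UNIV. a i * (D i x)\<^sup>2) * cutoff R x)"
        by (intro continuous_intros D_cont continuous_on_subset[OF cutoff_facts(1)]) auto
    qed (rule trunc_sq_zero)
    show "f n x = 0" if "x \<notin> cball 0 (sqrt R)" for x using off[OF that] by (simp add: f_def)
  qed
  have f_le: "integral\<^sup>L lborel (f n) \<le> C" for n
  proof -
    have "integral\<^sup>L lborel (f n) = (LINT x|lborel. trunc_sq (e n) (u x) * (\<Sum>i\<in>UNIV. a i * cutoff'' R i x))"
      unfolding f_eq using energy_identity[OF e] by (simp add: mult.assoc)
    also have "\<dots> \<le> C" unfolding C_def
    proof (rule integral_mono)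
      show "integrable lborel (\<lambda>x. trunc_sq (e n) (u x) * (\<Sum>i\<in>UNIV. a i * cutoff'' R i x))"
        using off continuous_on_compose2[OF continuous_trunc(1)[OF e] cont]
        by (intro integrable_continuous_compact_support[OF _ compact_cball[of 0 "sqrt R"]]
            continuous_intros cutoff_facts) auto
      show "integrable lborel (\<lambda>x. (u x)\<^sup>2 * \<bar>\<Sum>i\<in>UNIV. a i * cutoff'' R i x\<bar>)"
        using off by (intro integrable_continuous_compact_support[OF _ compact_cball[of 0 "sqrt R"]]
            continuous_intros cutoff_facts cont) auto
      show "trunc_sq (e n) (u x) * (\<Sum>i\<in>UNIV. a i * cutoff'' R i x) \<le> (u x)\<^sup>2 * \<bar>\<Sum>i\<in>UNIV. a i * cutoff'' R i x\<bar>" for x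
        by (rule order_trans[OF mult_left_mono[OF abs_ge_self trunc_bounds(1)[OF e]]
              mult_right_mono[OF trunc_bounds(2)[OF e] abs_ge_zero]])
    qed
    finally show ?thesis .
  qed
  have lim: "(\<lambda>n. f n x) \<longlonglongrightarrow> 2 * (energy x * cutoff R x)" for x
  proof (cases "0 < u x")
    case True
    have "(\<lambda>n. f n x) \<longlonglongrightarrow> 2 * energy x * cutoff R x"
      unfolding f_def e_def by (intro tendsto_intros trunc_limits True less_imp_le[OF True])
    then show ?thesis by (simp add: mult.assoc)
  next
    case False
    then have "energy x = 0" by (simp add: energy_def extended_gradient_def)
    then show ?thesis by (simp add: f_def)
  qed
  \<comment> \<open>Fatou's lemma, for the truncation levels \<open>1 / (n + 1)\<close>.\<close>
  have "(\<integral>\<^sup>+x. ennreal (2 * (energy x * cutoff R x)) \<partial>lborel) = (\<integral>\<^sup>+x. liminf (\<lambda>n. ennreal (f n x)) \<partial>lborel)"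
    using lim_imp_Liminf[OF trivial_limit_sequentially tendsto_ennrealI[OF lim]]
    by (intro nn_integral_cong) (rule sym)
  also have "\<dots> \<le> liminf (\<lambda>n. \<integral>\<^sup>+x. ennreal (f n x) \<partial>lborel)"
    by (rule nn_integral_liminf) measurable
  also have "\<dots> \<le> liminf (\<lambda>n::nat. ennreal C)"
    using f_le f_nonneg f_int by (intro Liminf_mono always_eventually) (auto simp: nn_integral_eq_integral ennreal_leI)
  also have "\<dots> < \<infinity>" by (simp add: Liminf_const)
  finally have "integrable lborel (\<lambda>x. 2 * (energy x * cutoff R x))"
    using mult_nonneg_nonneg[OF energy_nonneg cutoff_facts(6)] by (intro integrableI_nonneg) (auto simp: mult.commute)
  then show ?thesis by simp
qed

text \<open>A compact set lies in a ball on which a suitable cutoff is at least \<open>1\<close>.\<close>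

lemma gradient_square_integrable:
  assumes "compact K"
  shows "integrable lborel (\<lambda>x. indicator K x * (extended_gradient x $ i)\<^sup>2)"
proof -
  obtain r where r: "\<And>x. x \<in> K \<Longrightarrow> norm x \<le> r"
    using compact_imp_bounded[OF assms] unfolding bounded_iff by auto
  have K [measurable]: "K \<in> sets borel" using assms by (rule borel_compact)
  show ?thesis
  proof (rule Bochner_Integration.integrable_bound)
    show "integrable lborel (\<lambda>x. (1 / a i) * (energy x * cutoff (r\<^sup>2 + 1) x))"
      using energy_integrable by simp
    show "(\<lambda>x. indicator K x * (extended_gradient x $ i)\<^sup>2) \<in> borel_measurable lborel" by measurable
    show "AE x in lborel. norm (indicator K x * (extended_gradient x $ i)\<^sup>2) \<le> norm ((1 / a i) * (energy x * cutoff (r\<^sup>2 + 1) x))"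
    proof (rule AE_I2)
      fix x
      have nn: "0 \<le> energy x * cutoff (r\<^sup>2 + 1) x" using energy_nonneg cutoff_facts(6) by (rule mult_nonneg_nonneg)
      have "indicator K x * (a i * (extended_gradient x $ i)\<^sup>2) \<le> energy x * cutoff (r\<^sup>2 + 1) x"
      proof (cases "x \<in> K")
        case True
        have "(norm x)\<^sup>2 \<le> r\<^sup>2" using r[OF True] by (intro power_mono) auto
        then have "1 \<le> cutoff (r\<^sup>2 + 1) x" unfolding cutoff_def by (intro one_le_power) auto
        then have "energy x \<le> energy x * cutoff (r\<^sup>2 + 1) x" 
          using mult_left_mono[OF _ energy_nonneg, of 1] by fastforce
        moreover have "a i * (extended_gradient x $ i)\<^sup>2 \<le> energy x" unfolding energy_def
          using a_pos by (intro member_le_sum) (auto simp: less_imp_le)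
        ultimately show ?thesis using True by simp
      qed (use nn in simp)
      then show "norm (indicator K x * (extended_gradient x $ i)\<^sup>2) \<le> norm ((1 / a i) * (energy x * cutoff (r\<^sup>2 + 1) x))"
        using nn a_pos[of i] by (simp add: abs_of_nonneg del: abs_mult) (simp add: field_simps)
    qed
  qed
qed

lemma extended_gradient_borel_vec [measurable]: "extended_gradient \<in> borel_measurable borel"
  by (subst borel_measurable_euclidean_space) (auto simp: Basis_vec_def inner_axis)

lemma norm_extended_gradient_square: "(norm (extended_gradient x))\<^sup>2 = (\<Sum>i\<in>UNIV. (extended_gradient x $ i)\<^sup>2)"
  by (simp add: norm_vec_def L2_set_def sum_nonneg)

lemma gradient_norm_square_integrable:
  assumes "compact K"
  shows "integrable lborel (\<lambda>x. indicator K x * (norm (extended_gradient x))\<^sup>2)"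
  unfolding norm_extended_gradient_square sum_distrib_left
  by (intro Bochner_Integration.integrable_sum gradient_square_integrable assms)

lemma borel_to_lebesgue: "f \<in> borel_measurable borel \<Longrightarrow> f \<in> borel_measurable lebesgue"
  by (rule measurable_completion) simp

lemma L2_loc_extended_gradient: "L2_loc extended_gradient"
  unfolding L2_loc_def set_integrable_def
proof (intro conjI allI impI)
  show "extended_gradient \<in> borel_measurable lebesgue" by (rule borel_to_lebesgue) measurable
  fix K :: "(real^'n) set" assume K: "compact K"
  have [measurable]: "K \<in> sets borel" using K by (rule borel_compact)
  show "integrable lebesgue (\<lambda>x. indicat_real K x *\<^sub>R (norm (extended_gradient x))\<^sup>2)"
    using gradient_norm_square_integrable[OF K] by (subst integrable_lebesgue_lborel) auto
qed

lemma L1_loc_extended_gradient: "L1_loc extended_gradient"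
  unfolding L1_loc_def set_integrable_def
proof (intro allI impI)
  fix K :: "(real^'n) set" assume K: "compact K"
  have [measurable]: "K \<in> sets borel" using K by (rule borel_compact)
  have "integrable lborel (\<lambda>x. indicator K x *\<^sub>R extended_gradient x)"
  proof (rule Bochner_Integration.integrable_bound)
    show "integrable lborel (\<lambda>x. indicat_real K x *\<^sub>R 1 + indicat_real K x * (norm (extended_gradient x))\<^sup>2)"
      using K by (intro Bochner_Integration.integrable_add gradient_norm_square_integrable borel_integrable_compact) auto
    show "AE x in lborel. norm (indicat_real K x *\<^sub>R extended_gradient x) \<le> norm (indicat_real K x *\<^sub>R 1 + indicat_real K x * (norm (extended_gradient x))\<^sup>2)"
    proof (rule AE_I2)
      fix x
      have "0 \<le> (norm (extended_gradient x) - 1)\<^sup>2" by simp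
      then have "2 * norm (extended_gradient x) \<le> 1 + (norm (extended_gradient x))\<^sup>2" by (simp add: power2_eq_square algebra_simps)
      then have "norm (extended_gradient x) \<le> 1 + (norm (extended_gradient x))\<^sup>2" using norm_ge_zero[of "extended_gradient x"] by linarith
      then show "norm (indicat_real K x *\<^sub>R extended_gradient x) \<le> norm (indicat_real K x *\<^sub>R 1 + indicat_real K x * (norm (extended_gradient x))\<^sup>2)"
        by (auto simp: indicator_def)
    qed
  qed measurable
  then show "integrable lebesgue (\<lambda>x. indicat_real K x *\<^sub>R extended_gradient x)"
    by (subst integrable_lebesgue_lborel) auto
qed

lemma set_integrable_continuous:
  fixes f :: "real^'n \<Rightarrow> real"
  assumes "continuous_on UNIV f" "compact K"
  shows "set_integrable lebesgue K f"
proof -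
  have [measurable]: "f \<in> borel_measurable borel" using assms(1) by (rule borel_measurable_continuous_onI)
  have [measurable]: "K \<in> sets borel" using assms(2) by (rule borel_compact)
  have "integrable lborel (\<lambda>x. indicator K x *\<^sub>R f x)"
    using assms by (intro borel_integrable_compact) (auto intro: continuous_on_subset)
  then show ?thesis unfolding set_integrable_def by (subst integrable_lebesgue_lborel) auto
qed

text \<open>For the truncated function \<open>\<Theta>' \<circ> u\<close> the integration by parts is classical. Dominated
  convergence, with \<open>\<bar>\<Theta>'(u)\<bar> \<le> 2 u\<close> and \<open>\<bar>\<Theta>''\<bar> \<le> 2\<close>, gives the identity for \<open>2 u\<close>.\<close>

lemma has_weak_gradient_extended_gradient: "has_weak_gradient u extended_gradient"
  unfolding has_weak_gradient_def
proof (intro conjI allI impI)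
  show "L1_loc u" unfolding L1_loc_def using set_integrable_continuous[OF cont] by blast
  show "L1_loc extended_gradient" by (rule L1_loc_extended_gradient)
  fix \<phi> i assume \<phi>: "test_function UNIV (\<phi> :: real^'n \<Rightarrow> real)"
  note tf = test_function_facts[OF \<phi>]
  define K where "K = closure {x. \<phi> x \<noteq> 0}"
  define d where "d = partial_deriv i \<phi>"
  have K: "compact K" using tf(4) by (simp add: K_def)
  have off: "x \<notin> K \<Longrightarrow> \<phi> x = 0" "x \<notin> K \<Longrightarrow> d x = 0" for x
    unfolding K_def d_def by (rule tf; assumption)+
  have cd: "continuous_on UNIV d" unfolding d_def by (rule tf)
  have [measurable]: "d \<in> borel_measurable borel" "\<phi> \<in> borel_measurable borel"
    using cd tf(1) by (auto intro: borel_measurable_continuous_onI)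
  have [measurable]: "K \<in> sets borel" using K by (rule borel_compact)
  define e where "e n = 1 / real (Suc n)" for n
  have e: "e n > 0" for n by (simp add: e_def)
  note [measurable] = trunc_borel[OF e]
  have ibp: "(LINT x|lborel. trunc_sq'' (e n) (u x) * extended_gradient x $ i * \<phi> x) = - (LINT x|lborel. trunc_sq' (e n) (u x) * d x)" for n
  proof (rule integration_by_parts_compact_support[where e = "axis i 1" and K = K])
    fix x
    have "((\<lambda>t. trunc_sq' (e n) (u (x + t *\<^sub>R axis i 1))) has_real_derivative trunc_sq'' (e n) (u x) * D i x) (at 0)"
      using DERIV_truncated[OF e DERIV_trunc(2)[OF e], of n n "\<lambda>_. 1" i "\<lambda>_. 0" x]
      by (simp add: trunc_sq_zero)
    moreover have "trunc_sq'' (e n) (u x) * D i x = trunc_sq'' (e n) (u x) * extended_gradient x $ i"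
      using e[of n] by (cases "0 < u x") (auto simp: extended_gradient_def trunc_sq_zero)
    ultimately show "((\<lambda>t. trunc_sq' (e n) (u (x + t *\<^sub>R axis i 1))) has_real_derivative trunc_sq'' (e n) (u x) * extended_gradient x $ i) (at 0)"
      by simp
    show "((\<lambda>t. \<phi> (x + t *\<^sub>R axis i 1)) has_real_derivative d x) (at 0)" unfolding d_def by (rule tf)
  next
    show "continuous_on UNIV (\<lambda>x. trunc_sq' (e n) (u x))"
      by (rule continuous_on_compose2[OF continuous_trunc(2)[OF e] cont]) auto
    have "continuous_on UNIV (\<lambda>x. trunc_sq'' (e n) (u x) * extended_gradient x $ i)
       \<longleftrightarrow> continuous_on UNIV (\<lambda>x. trunc_sq'' (e n) (u x) * D i x)"
      using e[of n] by (intro continuous_on_cong refl) (auto simp: extended_gradient_def trunc_sq_zero)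
    moreover have "continuous_on UNIV (\<lambda>x. trunc_sq'' (e n) (u x) * D i x)"
      by (rule continuous_truncated[OF e continuous_trunc(3)[OF e] _ D_cont]) (rule trunc_sq_zero)
    ultimately show "continuous_on UNIV (\<lambda>x. trunc_sq'' (e n) (u x) * extended_gradient x $ i)" by simp
  qed (use tf(1) cd K off in auto)
  have l1: "(\<lambda>n. LINT x|lborel. trunc_sq' (e n) (u x) * d x) \<longlonglongrightarrow> (LINT x|lborel. 2 * u x * d x)"
  proof (rule integral_dominated_convergence[where w = "\<lambda>x. 2 * u x * \<bar>d x\<bar>"])
    show "integrable lborel (\<lambda>x. 2 * u x * \<bar>d x\<bar>)"
      using off(2) by (intro integrable_continuous_compact_support[OF _ K] continuous_intros cont cd) auto
    show "AE x in lborel. (\<lambda>n. trunc_sq' (e n) (u x) * d x) \<longlonglongrightarrow> 2 * u x * d x"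
      unfolding e_def by (intro AE_I2 tendsto_intros trunc_limits nonneg)
    show "AE x in lborel. norm (trunc_sq' (e n) (u x) * d x) \<le> 2 * u x * \<bar>d x\<bar>" for n
    proof (rule AE_I2)
      fix x
      have "\<bar>trunc_sq' (e n) (u x)\<bar> \<le> 2 * u x" using trunc_bounds(3)[OF e, of n "u x"] nonneg[of x] by simp
      then show "norm (trunc_sq' (e n) (u x) * d x) \<le> 2 * u x * \<bar>d x\<bar>"
        by (simp add: abs_mult mult_right_mono)
    qed
  qed measurable
  have l2: "(\<lambda>n. LINT x|lborel. trunc_sq'' (e n) (u x) * extended_gradient x $ i * \<phi> x) \<longlonglongrightarrow> (LINT x|lborel. 2 * extended_gradient x $ i * \<phi> x)"
  proof (rule integral_dominated_convergence[where w = "\<lambda>x. \<phi> x * \<phi> x + indicator K x * (extended_gradient x $ i)\<^sup>2"])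
    show "integrable lborel (\<lambda>x. \<phi> x * \<phi> x + indicator K x * (extended_gradient x $ i)\<^sup>2)"
      using off(1) by (intro Bochner_Integration.integrable_add gradient_square_integrable K
          integrable_continuous_compact_support[OF _ K] continuous_intros tf(1)) auto
    show "AE x in lborel. (\<lambda>n. trunc_sq'' (e n) (u x) * extended_gradient x $ i * \<phi> x) \<longlonglongrightarrow> 2 * extended_gradient x $ i * \<phi> x"
    proof (rule AE_I2)
      fix x show "(\<lambda>n. trunc_sq'' (e n) (u x) * extended_gradient x $ i * \<phi> x) \<longlonglongrightarrow> 2 * extended_gradient x $ i * \<phi> x"
      proof (cases "0 < u x")
        case True
        then show ?thesis unfolding e_def by (intro tendsto_intros trunc_limits) auto
      qed (simp add: extended_gradient_def)
    qed
    show "AE x in lborel. norm (trunc_sq'' (e n) (u x) * extended_gradient x $ i * \<phi> x) \<le> \<phi> x * \<phi> x + indicator K x * (extended_gradient x $ i)\<^sup>2" for n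
    proof (rule AE_I2)
      fix x
      let ?g = "extended_gradient x $ i"
      have "\<bar>trunc_sq'' (e n) (u x)\<bar> \<le> 2" using trunc_bounds(4,5)[OF e, of n] by simp
      then have "\<bar>trunc_sq'' (e n) (u x)\<bar> * \<bar>?g * \<phi> x\<bar> \<le> 2 * \<bar>?g * \<phi> x\<bar>" by (intro mult_right_mono) auto
      also have "\<dots> \<le> ?g\<^sup>2 + (\<phi> x)\<^sup>2"
      proof -
        have "0 \<le> (\<bar>?g\<bar> - \<bar>\<phi> x\<bar>)\<^sup>2" by simp
        then show ?thesis by (simp add: power2_eq_square abs_mult algebra_simps)
      qed
      finally have *: "norm (trunc_sq'' (e n) (u x) * ?g * \<phi> x) \<le> ?g\<^sup>2 + (\<phi> x)\<^sup>2" by (simp add: abs_mult mult.assoc)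
      show "norm (trunc_sq'' (e n) (u x) * ?g * \<phi> x) \<le> \<phi> x * \<phi> x + indicator K x * ?g\<^sup>2"
      proof (cases "x \<in> K")
        case True
        then show ?thesis using * by (simp add: power2_eq_square)
      next
        case False
        then show ?thesis using off(1) by simp
      qed
    qed
  qed measurable
  have "(LINT x|lborel. 2 * extended_gradient x $ i * \<phi> x) = - (LINT x|lborel. 2 * u x * d x)"
    using l2 tendsto_minus[OF l1] unfolding ibp by (rule LIMSEQ_unique)
  then have "(LINT x|lborel. u x * d x) = - (LINT x|lborel. extended_gradient x $ i * \<phi> x)"
    by (simp add: mult.assoc)
  then show "(LINT x|lebesgue. u x * partial_deriv i \<phi> x) = - (LINT x|lebesgue. extended_gradient x $ i * \<phi> x)"
    unfolding d_def[symmetric] by (subst (1 2) integrable_lebesgue_lborel) auto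
qed

lemma H1_loc_u: "H1_loc u"
  unfolding H1_loc_def
proof (intro conjI exI)
  show "has_weak_gradient u extended_gradient" by (rule has_weak_gradient_extended_gradient)
  show "L2_loc extended_gradient" by (rule L2_loc_extended_gradient)
  show "L2_loc u" unfolding L2_loc_def
    using cont by (auto intro!: borel_to_lebesgue set_integrable_continuous continuous_intros)
qed

text \<open>A test function supported in \<open>{u > 0}\<close> cuts the gradient of \<open>u\<close> off smoothly, so one more
  integration by parts leads back to the classical equation.\<close>

lemma div_zero:
  assumes A: "\<And>i x. (A *v x) $ i = a i * x $ i"
  shows "div_A_grad_zero_in {x. 0 < u x} A u"
  unfolding div_A_grad_zero_in_def div_zero_in_def
proof (intro exI conjI allI impI)
  show "has_weak_gradient u extended_gradient" by (rule has_weak_gradient_extended_gradient)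
  fix \<phi> assume \<phi>: "test_function {x. 0 < u x} \<phi>"
  note tf = test_function_facts[OF \<phi>]
  define K where "K = closure {x. \<phi> x \<noteq> 0}"
  define H where "H i x = (if 0 < u x then D2 i x else 0)" for i x
  have K: "compact K" using tf(4) by (simp add: K_def)
  have Kpos: "x \<in> K \<Longrightarrow> 0 < u x" for x using tf(5) by (auto simp: K_def)
  have off: "x \<notin> K \<Longrightarrow> \<phi> x = 0" "x \<notin> K \<Longrightarrow> partial_deriv i \<phi> x = 0" for x i
    unfolding K_def by (rule tf; assumption)+
  have oK: "open (- K)" using K by (simp add: compact_imp_closed open_Compl)
  have cc: "continuous_on UNIV (\<lambda>x. (if 0 < u x then E x else 0) * \<psi> x)"
    if "continuous_on {x. 0 < u x} E" "continuous_on UNIV \<psi>" "\<And>x. x \<notin> K \<Longrightarrow> \<psi> x = 0" for E \<psi> :: "real^'n \<Rightarrow> real"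
  proof (rule continuous_on_split_cover[OF open_pos oK])
    have "continuous_on {x. 0 < u x} (\<lambda>x. E x * \<psi> x)"
      using that by (intro continuous_intros) (auto intro: continuous_on_subset)
    then show "continuous_on {x. 0 < u x} (\<lambda>x. (if 0 < u x then E x else 0) * \<psi> x)"
      by (subst continuous_on_cong[OF refl]) auto
    show "continuous_on (- K) (\<lambda>x. (if 0 < u x then E x else 0) * \<psi> x)"
      using that(3) by (subst continuous_on_cong[OF refl, where g = "\<lambda>x. 0"]) auto
    show "{x. 0 < u x} \<union> - K = UNIV" using Kpos by auto
  qed
  have c1: "continuous_on UNIV (\<lambda>x. extended_gradient x $ i * \<phi> x)" "continuous_on UNIV (\<lambda>x. extended_gradient x $ i * partial_deriv i \<phi> x)"
    "continuous_on UNIV (\<lambda>x. H i x * \<phi> x)" for i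
    unfolding extended_gradient_def H_def vec_lambda_beta using D_cont D2_cont tf(1,2) off by (auto intro!: cc)
  have i1: "integrable lborel (\<lambda>x. extended_gradient x $ i * partial_deriv i \<phi> x)" "integrable lborel (\<lambda>x. H i x * \<phi> x)" for i
    using c1 off by (auto intro!: integrable_continuous_compact_support[OF _ K])
  have "integral\<^sup>L lborel (\<lambda>x. extended_gradient x $ i * partial_deriv i \<phi> x + H i x * \<phi> x) = 0" for i
  proof (rule integral_compactly_supported_derivative[where e = "axis i 1" and K = K and g = "\<lambda>x. extended_gradient x $ i * \<phi> x"])
    fix x
    show "((\<lambda>t. extended_gradient (x + t *\<^sub>R axis i 1) $ i * \<phi> (x + t *\<^sub>R axis i 1)) has_real_derivative
        extended_gradient x $ i * partial_deriv i \<phi> x + H i x * \<phi> x) (at 0)"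
    proof (cases "0 < u x")
      case True
      have "eventually (\<lambda>t. x + t *\<^sub>R axis i 1 \<in> {x. 0 < u x}) (nhds 0)"
        using True by (intro eventually_along_line open_pos) simp
      then have ev: "eventually (\<lambda>t. D i (x + t *\<^sub>R axis i 1) * \<phi> (x + t *\<^sub>R axis i 1) =
          extended_gradient (x + t *\<^sub>R axis i 1) $ i * \<phi> (x + t *\<^sub>R axis i 1)) (nhds 0)"
        by eventually_elim (simp add: extended_gradient_def)
      have "((\<lambda>t. D i (x + t *\<^sub>R axis i 1) * \<phi> (x + t *\<^sub>R axis i 1)) has_real_derivative
         extended_gradient x $ i * partial_deriv i \<phi> x + H i x * \<phi> x) (at 0)"
        using DERIV_mult[OF D2_der[OF True] tf(3)] True by (simp add: extended_gradient_def H_def algebra_simps)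
      then show ?thesis by (subst (asm) DERIV_cong_ev[OF refl ev refl])
    next
      case False
      then have x: "x \<in> - K" using Kpos by auto
      have "eventually (\<lambda>t. x + t *\<^sub>R axis i 1 \<in> - K) (nhds 0)"
        by (rule eventually_along_line[OF oK x])
      then have "eventually (\<lambda>t. extended_gradient (x + t *\<^sub>R axis i 1) $ i * \<phi> (x + t *\<^sub>R axis i 1) = 0) (nhds 0)"
        by eventually_elim (simp add: off)
      then have "((\<lambda>t. extended_gradient (x + t *\<^sub>R axis i 1) $ i * \<phi> (x + t *\<^sub>R axis i 1)) has_real_derivative 0) (at 0)"
        by (rule DERIV_locally_zero)
      then show ?thesis using False by (simp add: extended_gradient_def H_def)
    qed
  qed (use c1 K off in \<open>auto intro!: continuous_on_add\<close>)
  note sum0 = this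
  have i0: "(LINT x|lborel. extended_gradient x $ i * partial_deriv i \<phi> x) = - (LINT x|lborel. H i x * \<phi> x)" for i
    using sum0[of i] i1[of i] by simp
  have eq: "(\<lambda>x. (A *v extended_gradient x) \<bullet> grad \<phi> x) = (\<lambda>x. \<Sum>i\<in>UNIV. a i * (extended_gradient x $ i * partial_deriv i \<phi> x))"
    by (simp add: inner_vec_def A grad_def mult.assoc)
  have "(LINT x|lborel. (A *v extended_gradient x) \<bullet> grad \<phi> x) = (\<Sum>i\<in>UNIV. a i * (LINT x|lborel. extended_gradient x $ i * partial_deriv i \<phi> x))"
    unfolding eq using i1 by (simp add: Bochner_Integration.integral_sum)
  also have "\<dots> = - (\<Sum>i\<in>UNIV. a i * (LINT x|lborel. H i x * \<phi> x))"
    unfolding i0 by (simp add: sum_negf)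
  also have "(\<Sum>i\<in>UNIV. a i * (LINT x|lborel. H i x * \<phi> x)) = (LINT x|lborel. (\<Sum>i\<in>UNIV. a i * (H i x * \<phi> x)))"
    using i1 by (simp add: Bochner_Integration.integral_sum)
  also have "(\<lambda>x. \<Sum>i\<in>UNIV. a i * (H i x * \<phi> x)) = (\<lambda>x. 0)"
  proof
    fix x
    have "(\<Sum>i\<in>UNIV. a i * (H i x * \<phi> x)) = (\<Sum>i\<in>UNIV. a i * H i x) * \<phi> x"
      by (simp add: sum_distrib_right mult.assoc)
    also have "(\<Sum>i\<in>UNIV. a i * H i x) = 0" using eqn[of x] by (cases "0 < u x") (simp_all add: H_def)
    finally show "(\<Sum>i\<in>UNIV. a i * (H i x * \<phi> x)) = 0" by simp
  qed
  finally have "(LINT x|lborel. (A *v extended_gradient x) \<bullet> grad \<phi> x) = 0" by simp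
  moreover have "(\<lambda>x. (A *v extended_gradient x) \<bullet> grad \<phi> x) \<in> borel_measurable borel"
    unfolding eq by (intro borel_measurable_continuous_onI continuous_on_sum continuous_on_mult_left c1(2))
  ultimately show "(LINT x|lebesgue. (A *v extended_gradient x) \<bullet> grad \<phi> x) = 0"
    by (simp add: integrable_lebesgue_lborel)
qed

end

section \<open>Homogeneous harmonic functions around a half-plane\<close>

lemma Re_powr_polar:
  assumes "\<zeta> \<noteq> 0"
  shows "Re (\<zeta> powr complex_of_real s) = cmod \<zeta> powr s * cos (s * Arg \<zeta>)"
    and "Im (\<zeta> powr complex_of_real s) = cmod \<zeta> powr s * sin (s * Arg \<zeta>)"
proof -
  have "Ln \<zeta> = Complex (ln (cmod \<zeta>)) (Arg \<zeta>)"
    using assms by (simp add: complex_eq_iff Arg_eq_Im_Ln)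
  then show "Re (\<zeta> powr complex_of_real s) = cmod \<zeta> powr s * cos (s * Arg \<zeta>)"
    "Im (\<zeta> powr complex_of_real s) = cmod \<zeta> powr s * sin (s * Arg \<zeta>)"
    using assms by (simp_all add: powr_def Re_exp Im_exp)
qed

lemma has_vector_derivative_powr_line:
  fixes c :: "real \<Rightarrow> complex"
  assumes "(c has_vector_derivative c') (at t)" "c t \<notin> \<real>\<^sub>\<le>\<^sub>0"
  shows "((\<lambda>t. c t powr s) has_vector_derivative (s * c t powr (s - 1) * c')) (at t)"
  using field_vector_diff_chain_at[OF assms(1) has_field_derivative_powr[OF assms(2), of s]]
  by (simp add: o_def mult.commute)

lemma DERIV_Re:
  assumes "(f has_vector_derivative f') F"
  shows "((\<lambda>t. Re (f t)) has_vector_derivative Re f') F"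
  using bounded_linear.has_vector_derivative[OF bounded_linear_Re assms] .

text \<open>The dependence of the profile below on the slope \<open>\<tau> = z / r\<close> with respect to the plane of
  \<open>\<zeta>\<close>. In terms of the latitude \<open>\<omega>\<close> it is \<open>cos (p \<omega>) / (cos \<omega>)\<^sup>p\<close>.\<close>

definition latitude_factor :: "real \<Rightarrow> real \<Rightarrow> real" where
  "latitude_factor p \<tau> = Re (Complex 1 \<tau> powr complex_of_real p)"

text \<open>The derivative is \<open>- p Im ((1 + i \<tau>)\<^sup>p\<^sup>-\<^sup>1)\<close>, and for \<open>\<tau> \<ge> 0\<close> the argument of
  \<open>(1 + i \<tau>)\<^sup>p\<^sup>-\<^sup>1\<close> lies in \<open>[0, \<pi>]\<close>.\<close>

lemma latitude_factor_antimono: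
  assumes "1 \<le> p" "p \<le> 2" "0 \<le> \<sigma>" "\<sigma> \<le> \<tau>"
  shows "latitude_factor p \<tau> \<le> latitude_factor p \<sigma>"
proof (rule DERIV_nonpos_imp_nonincreasing[OF assms(4)])
  fix t assume "\<sigma> \<le> t" "t \<le> \<tau>"
  then have t: "0 \<le> t" using assms by simp
  let ?c = "Complex 1 t" and ?p = "complex_of_real p"
  have c: "?c \<notin> \<real>\<^sub>\<le>\<^sub>0" "?c \<noteq> 0" by (auto simp: complex_nonpos_Reals_iff complex_eq_iff)
  have "((\<lambda>t. Complex 1 t) has_vector_derivative \<i>) (at t)"
    unfolding Complex_eq by (auto intro!: derivative_eq_intros)
  from DERIV_Re[OF has_vector_derivative_powr_line[OF this c(1), of ?p]]
  have d: "(latitude_factor p has_real_derivative Re (?p * ?c powr (?p - 1) * \<i>)) (at t)"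
    unfolding latitude_factor_def has_real_derivative_iff_has_vector_derivative .
  have "Re (?p * ?c powr (?p - 1) * \<i>) = - (p * Im (?c powr complex_of_real (p - 1)))" by simp
  also have "\<dots> = - (p * (cmod ?c powr (p - 1) * sin ((p - 1) * Arg ?c)))"
    by (simp only: Re_powr_polar(2)[OF c(2)])
  also have "\<dots> \<le> 0"
  proof -
    have A: "0 \<le> Arg ?c" "Arg ?c \<le> pi" using t by (auto simp: Arg_less_0 Arg_le_pi)
    then have "(p - 1) * Arg ?c \<le> pi" using assms mult_mono[of "p - 1" 1 "Arg ?c" pi] by simp
    then have "0 \<le> sin ((p - 1) * Arg ?c)" using A assms by (intro sin_ge_zero) auto
    then show ?thesis using assms by simp
  qed
  finally show "\<exists>y. (latitude_factor p has_real_derivative y) (at t) \<and> y \<le> 0" using d by blast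
qed

lemma latitude_factor_0: "latitude_factor p 0 = 1"
proof -
  have "Complex 1 0 = 1" by (simp add: complex_eq_iff)
  then show ?thesis by (simp add: latitude_factor_def)
qed

lemma latitude_factor_minus: "latitude_factor p (- \<tau>) = latitude_factor p \<tau>"
proof -
  have "Complex 1 (- \<tau>) = cnj (Complex 1 \<tau>)" by (simp add: complex_eq_iff)
  moreover have "Complex 1 \<tau> \<notin> \<real>\<^sub>\<le>\<^sub>0" by (simp add: complex_nonpos_Reals_iff)
  ultimately have "Complex 1 (- \<tau>) powr complex_of_real p = cnj (Complex 1 \<tau> powr complex_of_real p)"
    by (simp add: cnj_powr)
  then show ?thesis by (simp add: latitude_factor_def)
qed

lemma latitude_factor_abs: "latitude_factor p \<bar>\<tau>\<bar> = latitude_factor p \<tau>"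
  by (cases "0 \<le> \<tau>") (simp_all add: latitude_factor_minus)

lemma latitude_factor_le_1: "1 \<le> p \<Longrightarrow> p \<le> 2 \<Longrightarrow> latitude_factor p \<tau> \<le> 1"
  using latitude_factor_antimono[of p 0 "\<bar>\<tau>\<bar>"] by (simp add: latitude_factor_0 latitude_factor_abs)

text \<open>The first summand is \<open>r\<^sup>a cos (a \<phi>)\<close>. The second one is a solid harmonic of degree \<open>a\<close> and
  order \<open>1/2\<close>, for which the associated Legendre function is elementary: \<open>r\<^sup>-\<^sup>1\<^sup>/\<^sup>2 f(r, z) cos (m \<phi>)\<close> has
  Laplacian \<open>r\<^sup>-\<^sup>1\<^sup>/\<^sup>2 (f\<^sub>r\<^sub>r + f\<^sub>z\<^sub>z + (1/4 - m\<^sup>2) f / r\<^sup>2) cos (m \<phi>)\<close>, so that for \<open>m = 1/2\<close> any function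
  \<open>f\<close> harmonic in the half-plane \<open>r > 0\<close> is admissible, here \<open>f = Re ((r + i z)\<^sup>a\<^sup>+\<^sup>1\<^sup>/\<^sup>2)\<close>.\<close>

definition profile :: "real \<Rightarrow> real \<Rightarrow> complex \<Rightarrow> real \<Rightarrow> real" where
  "profile a \<epsilon> \<zeta> z = Re (\<zeta> powr complex_of_real a) +
     \<epsilon> * (Re (\<zeta> powr complex_of_real (- 1 / 2)) * Re (Complex (cmod \<zeta>) z powr complex_of_real (a + 1 / 2)))"

text \<open>Both summands are homogeneous of degree \<open>a\<close> in \<open>r\<close> once the slope \<open>z / r\<close> and the angle are
  held fixed. The sign of the profile is that of the bracket.\<close>

lemma profile_polar:
  assumes "\<zeta> \<noteq> 0"
  shows "profile a \<epsilon> \<zeta> z = cmod \<zeta> powr a *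
    (cos (a * Arg \<zeta>) + \<epsilon> * (cos (Arg \<zeta> / 2) * latitude_factor (a + 1 / 2) (z / cmod \<zeta>)))"
proof -
  let ?r = "cmod \<zeta>"
  have r: "?r > 0" using assms by simp
  have "Complex ?r z = complex_of_real ?r * Complex 1 (z / ?r)"
    using r by (simp add: complex_eq_iff)
  then have "Complex ?r z powr complex_of_real (a + 1 / 2) =
      complex_of_real ?r powr complex_of_real (a + 1 / 2) * Complex 1 (z / ?r) powr complex_of_real (a + 1 / 2)"
    by (simp add: powr_times_real_left)
  also have "complex_of_real ?r powr complex_of_real (a + 1 / 2) = complex_of_real (?r powr (a + 1 / 2))"
    using r by (simp add: powr_of_real del: of_real_add of_real_divide)
  finally have "Re (Complex ?r z powr complex_of_real (a + 1 / 2)) = ?r powr (a + 1 / 2) * latitude_factor (a + 1 / 2) (z / ?r)"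
    by (simp add: latitude_factor_def)
  moreover have "?r powr (- 1 / 2) * ?r powr (a + 1 / 2) = ?r powr a"
    by (simp flip: powr_add)
  moreover have "cos (- 1 / 2 * Arg \<zeta>) = cos (Arg \<zeta> / 2)" using cos_minus[of "Arg \<zeta> / 2"] by simp
  ultimately show ?thesis
    unfolding profile_def Re_powr_polar[OF assms] by (simp add: algebra_simps)
qed

lemma profile_zero [simp]: "profile a \<epsilon> 0 z = 0"
  by (simp add: profile_def)

lemma profile_homogeneous:
  assumes "t > 0"
  shows "profile a \<epsilon> (t *\<^sub>R \<zeta>) (t * z) = t powr a * profile a \<epsilon> \<zeta> z"
proof (cases "\<zeta> = 0")
  case False
  have "Arg (t *\<^sub>R \<zeta>) = Arg \<zeta>" using assms by (simp add: scaleR_conv_of_real)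
  then show ?thesis using False assms by (simp add: profile_polar powr_mult)
qed simp

lemma profile_upper:
  assumes "1 / 2 < a" "a < 3 / 2" "0 \<le> \<epsilon>" "\<zeta> \<noteq> 0"
  shows "profile a \<epsilon> \<zeta> z \<le> cmod \<zeta> powr a * (cos (a * Arg \<zeta>) + \<epsilon> * cos (Arg \<zeta> / 2))"
proof -
  have "0 \<le> cos (Arg \<zeta> / 2)"
    using mpi_less_Arg[of \<zeta>] Arg_le_pi[of \<zeta>] by (intro cos_ge_zero) auto
  then have "cos (Arg \<zeta> / 2) * latitude_factor (a + 1 / 2) (z / cmod \<zeta>) \<le> cos (Arg \<zeta> / 2)"
    using latitude_factor_le_1[of "a + 1 / 2"] assms by (simp add: mult_left_le)
  then show ?thesis unfolding profile_polar[OF assms(4)]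
    using assms by (intro mult_left_mono add_left_mono) auto
qed

text \<open>On the cut \<open>\<phi> = \<pi>\<close> the bracket reduces to \<open>cos (a \<pi>)\<close>, which is negative in this range of
  degrees. So the positivity set never meets the set where the profile fails to be smooth.\<close>

lemma profile_pos_imp:
  assumes "1 / 2 < a" "a < 3 / 2" "0 \<le> \<epsilon>" "0 < profile a \<epsilon> \<zeta> z"
  shows "\<zeta> \<notin> \<real>\<^sub>\<le>\<^sub>0" "0 < cos (a * Arg \<zeta>) + \<epsilon> * (cos (Arg \<zeta> / 2) * latitude_factor (a + 1 / 2) (z / cmod \<zeta>))"
    "0 < cos (a * Arg \<zeta>) + \<epsilon> * cos (Arg \<zeta> / 2)"
proof -
  have nz: "\<zeta> \<noteq> 0" using assms(4) by auto
  show "0 < cos (a * Arg \<zeta>) + \<epsilon> * (cos (Arg \<zeta> / 2) * latitude_factor (a + 1 / 2) (z / cmod \<zeta>))"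
    using assms(4) nz unfolding profile_polar[OF nz] by (simp add: zero_less_mult_iff)
  show *: "0 < cos (a * Arg \<zeta>) + \<epsilon> * cos (Arg \<zeta> / 2)"
    using order.strict_trans2[OF assms(4) profile_upper[OF assms(1-3) nz]] nz by (simp add: zero_less_mult_iff)
  show "\<zeta> \<notin> \<real>\<^sub>\<le>\<^sub>0"
  proof
    assume "\<zeta> \<in> \<real>\<^sub>\<le>\<^sub>0"
    then have "Arg \<zeta> = pi" using nz by (auto simp: Arg_eq_pi complex_nonpos_Reals_iff complex_eq_iff)
    moreover have "cos (a * pi) < 0"
    proof -
      have "cos (pi - a * pi) > 0" using assms by (intro cos_gt_zero_pi) (auto simp: field_simps)
      then show ?thesis by (simp add: cos_diff)
    qed
    ultimately show False using * by simp
  qed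
qed

text \<open>First derivative of \<open>\<bar>\<zeta>\<bar>\<close> in direction \<open>d\<close>; the second one is \<open>rad2\<close>.\<close>

definition rad1 :: "complex \<Rightarrow> complex \<Rightarrow> real" where
  "rad1 d \<zeta> = (Re \<zeta> * Re d + Im \<zeta> * Im d) / cmod \<zeta>"

definition rad2 :: "complex \<Rightarrow> complex \<Rightarrow> real" where
  "rad2 d \<zeta> = ((cmod d)\<^sup>2 - (rad1 d \<zeta>)\<^sup>2) / cmod \<zeta>"

text \<open>First derivative of \<open>\<zeta>\<^sup>s\<close> along a curve with velocity \<open>d\<close>; in \<open>powr_deriv2\<close> the curve also has
  acceleration \<open>dd\<close>, which for the curve \<open>r + i z\<close> is the second derivative of \<open>r\<close>.\<close>

definition powr_deriv1 :: "real \<Rightarrow> complex \<Rightarrow> complex \<Rightarrow> complex" where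
  "powr_deriv1 s d \<zeta> = complex_of_real s * \<zeta> powr (complex_of_real s - 1) * d"

definition powr_deriv2 :: "real \<Rightarrow> complex \<Rightarrow> complex \<Rightarrow> complex \<Rightarrow> complex" where
  "powr_deriv2 s d dd \<zeta> = complex_of_real s * ((complex_of_real s - 1) * \<zeta> powr (complex_of_real s - 2) * d) * d +
     complex_of_real s * \<zeta> powr (complex_of_real s - 1) * dd"

text \<open>First and second derivatives of the profile along the line \<open>t \<mapsto> (\<zeta> + t d, z + t e)\<close>. One formula
  for all directions covers every coordinate axis of every linear embedding.\<close>

definition profile1 :: "real \<Rightarrow> real \<Rightarrow> complex \<Rightarrow> real \<Rightarrow> complex \<Rightarrow> real \<Rightarrow> real" where
  "profile1 a \<epsilon> d e \<zeta> z = Re (powr_deriv1 a d \<zeta>) +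
     \<epsilon> * (Re (powr_deriv1 (- 1 / 2) d \<zeta>) * Re (Complex (cmod \<zeta>) z powr complex_of_real (a + 1 / 2)) +
          Re (\<zeta> powr complex_of_real (- 1 / 2)) * Re (powr_deriv1 (a + 1 / 2) (Complex (rad1 d \<zeta>) e) (Complex (cmod \<zeta>) z)))"

definition profile2 :: "real \<Rightarrow> real \<Rightarrow> complex \<Rightarrow> real \<Rightarrow> complex \<Rightarrow> real \<Rightarrow> real" where
  "profile2 a \<epsilon> d e \<zeta> z = Re (powr_deriv2 a d 0 \<zeta>) +
     \<epsilon> * (Re (powr_deriv2 (- 1 / 2) d 0 \<zeta>) * Re (Complex (cmod \<zeta>) z powr complex_of_real (a + 1 / 2)) +
          2 * (Re (powr_deriv1 (- 1 / 2) d \<zeta>) * Re (powr_deriv1 (a + 1 / 2) (Complex (rad1 d \<zeta>) e) (Complex (cmod \<zeta>) z))) +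
          Re (\<zeta> powr complex_of_real (- 1 / 2)) *
            Re (powr_deriv2 (a + 1 / 2) (Complex (rad1 d \<zeta>) e) (complex_of_real (rad2 d \<zeta>)) (Complex (cmod \<zeta>) z)))"

lemma DERIV_cmod_line:
  assumes "\<zeta> \<noteq> 0"
  shows "((\<lambda>t. cmod (\<zeta> + t *\<^sub>R d)) has_real_derivative rad1 d \<zeta>) (at 0)"
proof -
  define q where "q t = (Re \<zeta> + t * Re d)\<^sup>2 + (Im \<zeta> + t * Im d)\<^sup>2" for t
  have q0: "0 < q 0" using assms by (simp add: q_def complex_neq_0)
  have "(q has_real_derivative 2 * (Re \<zeta> * Re d + Im \<zeta> * Im d)) (at 0)"
    unfolding q_def[abs_def] by (auto intro!: derivative_eq_intros)
  from DERIV_chain2[OF DERIV_real_sqrt[OF q0] this]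
  have "((\<lambda>t. sqrt (q t)) has_real_derivative rad1 d \<zeta>) (at 0)"
  proof (rule DERIV_cong)
    have "rad1 d \<zeta> = (Re \<zeta> * Re d + Im \<zeta> * Im d) / sqrt (q 0)" by (simp add: rad1_def q_def cmod_def)
    moreover have "inverse s / 2 * (2 * k) = k / s" for s k :: real by (simp add: field_simps)
    ultimately show "inverse (sqrt (q 0)) / 2 * (2 * (Re \<zeta> * Re d + Im \<zeta> * Im d)) = rad1 d \<zeta>"
      by (simp only:)
  qed
  then show ?thesis by (simp add: cmod_def q_def)
qed

lemma DERIV_rad1_line:
  assumes "\<zeta> \<noteq> 0"
  shows "((\<lambda>t. rad1 d (\<zeta> + t *\<^sub>R d)) has_real_derivative rad2 d \<zeta>) (at 0)"
proof -
  have r: "cmod \<zeta> > 0" using assms by simp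
  have n: "((\<lambda>t. Re (\<zeta> + t *\<^sub>R d) * Re d + Im (\<zeta> + t *\<^sub>R d) * Im d) has_real_derivative (cmod d)\<^sup>2) (at 0)"
    unfolding cmod_power2 by (auto intro!: derivative_eq_intros simp: power2_eq_square)
  have "((\<lambda>t. rad1 d (\<zeta> + t *\<^sub>R d)) has_real_derivative
      ((cmod d)\<^sup>2 * cmod \<zeta> - (Re \<zeta> * Re d + Im \<zeta> * Im d) * rad1 d \<zeta>) / (cmod \<zeta> * cmod \<zeta>)) (at 0)"
    unfolding rad1_def[abs_def] using DERIV_divide[OF n DERIV_cmod_line[OF assms, of d]] r
    by (simp add: rad1_def)
  moreover have "((cmod d)\<^sup>2 * cmod \<zeta> - (Re \<zeta> * Re d + Im \<zeta> * Im d) * rad1 d \<zeta>) / (cmod \<zeta> * cmod \<zeta>) = rad2 d \<zeta>"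
    using r by (simp add: rad2_def rad1_def power2_eq_square field_simps)
  ultimately show ?thesis by simp
qed

lemma has_vector_derivative_powr_deriv1:
  assumes "(c has_vector_derivative c1 t) (at t)" "(c1 has_vector_derivative c2) (at t)" "c t \<notin> \<real>\<^sub>\<le>\<^sub>0"
  shows "((\<lambda>t. powr_deriv1 s (c1 t) (c t)) has_vector_derivative powr_deriv2 s (c1 t) c2 (c t)) (at t)"
proof -
  have "((\<lambda>t. complex_of_real s * c t powr (complex_of_real s - 1) * c1 t) has_vector_derivative
     complex_of_real s * c t powr (complex_of_real s - 1) * c2 +
     complex_of_real s * ((complex_of_real s - 1) * c t powr (complex_of_real s - 1 - 1) * c1 t) * c1 t) (at t)"
    by (rule has_vector_derivative_mult has_vector_derivative_mult_right
        has_vector_derivative_powr_line assms)+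
  then show ?thesis by (simp add: powr_deriv1_def powr_deriv2_def add.commute)
qed

lemma DERIV_profile:
  assumes "\<zeta> \<notin> \<real>\<^sub>\<le>\<^sub>0"
  shows "((\<lambda>t. profile a \<epsilon> (\<zeta> + t *\<^sub>R d) (z + t * e)) has_real_derivative profile1 a \<epsilon> d e \<zeta> z) (at 0)"
    and "((\<lambda>t. profile1 a \<epsilon> d e (\<zeta> + t *\<^sub>R d) (z + t * e)) has_real_derivative profile2 a \<epsilon> d e \<zeta> z) (at 0)"
proof -
  have nz: "\<zeta> \<noteq> 0" using assms by auto
  define c where "c t = \<zeta> + t *\<^sub>R d" for t :: real
  define w where "w t = Complex (cmod (c t)) (z + t * e)" for t
  define w1 where "w1 t = Complex (rad1 d (c t)) e" for t
  have c0: "c 0 = \<zeta>" by (simp add: c_def)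
  have w0: "w 0 = Complex (cmod \<zeta>) z" "w1 0 = Complex (rad1 d \<zeta>) e" by (simp_all add: w_def w1_def c0)
  have cn: "c 0 \<notin> \<real>\<^sub>\<le>\<^sub>0" "w 0 \<notin> \<real>\<^sub>\<le>\<^sub>0"
    using assms nz by (auto simp: c0 w0 complex_nonpos_Reals_iff)
  have dc: "(c has_vector_derivative d) (at 0)" unfolding c_def by (auto intro!: derivative_eq_intros)
  have cplx: "((\<lambda>t. Complex (f t) (g t)) has_vector_derivative Complex f' g') (at 0)"
    if "(f has_real_derivative f') (at 0)" "(g has_real_derivative g') (at 0)" for f g f' g'
    using that unfolding Complex_eq
    by (auto intro!: derivative_eq_intros has_vector_derivative_of_real simp: has_real_derivative_iff_has_vector_derivative)
  have dw: "(w has_vector_derivative w1 0) (at 0)"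
    unfolding w_def w1_def using DERIV_cmod_line[OF nz, of d]
    by (intro cplx) (auto simp: c_def intro!: derivative_eq_intros)
  have dw1: "(w1 has_vector_derivative complex_of_real (rad2 d \<zeta>)) (at 0)"
    unfolding w1_def complex_of_real_def using DERIV_rad1_line[OF nz, of d]
    by (intro cplx) (auto simp: c_def intro!: derivative_eq_intros)
  have pw: "((\<lambda>t. Re (f t powr complex_of_real s)) has_real_derivative Re (powr_deriv1 s f' (f 0))) (at 0)"
    if "(f has_vector_derivative f') (at 0)" "f 0 \<notin> \<real>\<^sub>\<le>\<^sub>0" for f f' s
    using DERIV_Re[OF has_vector_derivative_powr_line[OF that, of "complex_of_real s"]]
    by (simp add: powr_deriv1_def has_real_derivative_iff_has_vector_derivative)
  have pw1: "((\<lambda>t. Re (powr_deriv1 s (f1 t) (f t))) has_real_derivative Re (powr_deriv2 s (f1 0) f2 (f 0))) (at 0)"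
    if "(f has_vector_derivative f1 0) (at 0)" "(f1 has_vector_derivative f2) (at 0)" "f 0 \<notin> \<real>\<^sub>\<le>\<^sub>0" for f f1 f2 s
    using DERIV_Re[OF has_vector_derivative_powr_deriv1[of f f1 0 f2 s]] that
    by (simp add: has_real_derivative_iff_has_vector_derivative)
  have pw1c: "((\<lambda>t. Re (powr_deriv1 s d (c t))) has_real_derivative Re (powr_deriv2 s d 0 \<zeta>)) (at 0)" for s
    using pw1[of c "\<lambda>_. d" 0 s] dc cn by (simp add: c0)
  note D = pw[OF dc cn(1), unfolded c0] pw[OF dw cn(2), unfolded w0] pw1c pw1[OF dw dw1 cn(2), unfolded w0]
  have "((\<lambda>t. Re (c t powr complex_of_real a) + \<epsilon> * (Re (c t powr complex_of_real (- 1 / 2)) *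
      Re (w t powr complex_of_real (a + 1 / 2)))) has_real_derivative profile1 a \<epsilon> d e \<zeta> z) (at 0)"
    by (rule DERIV_cong[OF DERIV_add[OF D(1) DERIV_cmult[OF DERIV_mult[OF D(1) D(2)]]]])
       (simp add: profile1_def c0 w0 mult_ac)
  then show "((\<lambda>t. profile a \<epsilon> (\<zeta> + t *\<^sub>R d) (z + t * e)) has_real_derivative profile1 a \<epsilon> d e \<zeta> z) (at 0)"
    by (simp only: profile_def w_def c_def)
  have "((\<lambda>t. Re (powr_deriv1 a d (c t)) +
     \<epsilon> * (Re (powr_deriv1 (- 1 / 2) d (c t)) * Re (w t powr complex_of_real (a + 1 / 2)) +
          Re (c t powr complex_of_real (- 1 / 2)) * Re (powr_deriv1 (a + 1 / 2) (w1 t) (w t))))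
     has_real_derivative profile2 a \<epsilon> d e \<zeta> z) (at 0)"
    by (rule DERIV_cong[OF DERIV_add[OF D(3) DERIV_cmult[OF DERIV_add[OF DERIV_mult[OF D(3) D(2)] DERIV_mult[OF D(1) D(4)]]]]])
       (simp add: profile2_def c0 w0 algebra_simps)
  then show "((\<lambda>t. profile1 a \<epsilon> d e (\<zeta> + t *\<^sub>R d) (z + t * e)) has_real_derivative profile2 a \<epsilon> d e \<zeta> z) (at 0)"
    by (simp only: profile1_def w_def c_def w1_def)
qed

lemma continuous_on_profile:
  assumes "continuous_on S c" "continuous_on S h" "\<And>x. x \<in> S \<Longrightarrow> c x \<notin> \<real>\<^sub>\<le>\<^sub>0"
  shows "continuous_on S (\<lambda>x. profile a \<epsilon> (c x) (h x))"
    "continuous_on S (\<lambda>x. profile1 a \<epsilon> d e (c x) (h x))"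
    "continuous_on S (\<lambda>x. profile2 a \<epsilon> d e (c x) (h x))"
proof -
  have nz: "x \<in> S \<Longrightarrow> c x \<noteq> 0" for x using assms(3)[of x] by auto
  have c': "\<And>x. x \<in> S \<Longrightarrow> 0 \<le> Re (c x) \<or> Im (c x) \<noteq> 0" using assms(3) by (force simp: complex_nonpos_Reals_iff)
  define w where "w x = Complex (cmod (c x)) (h x)" for x
  have cw: "continuous_on S w" unfolding w_def Complex_eq using assms by (intro continuous_intros) auto
  have w': "\<And>x. 0 \<le> Re (w x)" "\<And>x. x \<in> S \<Longrightarrow> w x \<noteq> 0" using nz by (auto simp: w_def complex_eq_iff)
  have powc: "continuous_on S (\<lambda>x. c x powr s)" "continuous_on S (\<lambda>x. w x powr s)" for s
  proof -
    show "continuous_on S (\<lambda>x. c x powr s)"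
      by (rule continuous_on_powr_complex) (use c' nz in \<open>auto intro: assms(1)\<close>)
    show "continuous_on S (\<lambda>x. w x powr s)"
      by (rule continuous_on_powr_complex) (use w' in \<open>auto intro: cw\<close>)
  qed
  have r1: "continuous_on S (\<lambda>x. rad1 d (c x))" unfolding rad1_def using assms nz by (intro continuous_intros) auto
  have r2: "continuous_on S (\<lambda>x. rad2 d (c x))" unfolding rad2_def using assms nz r1 by (intro continuous_intros) auto
  show "continuous_on S (\<lambda>x. profile a \<epsilon> (c x) (h x))"
    unfolding profile_def w_def[symmetric] by (intro powc r1 r2 assms(1,2) continuous_on_add continuous_on_mult continuous_on_const
        continuous_on_Re continuous_on_of_real)
  show "continuous_on S (\<lambda>x. profile1 a \<epsilon> d e (c x) (h x))"
    unfolding profile1_def powr_deriv1_def w_def[symmetric] unfolding Complex_eq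
    by (intro powc r1 r2 assms(1,2) continuous_on_add continuous_on_mult continuous_on_const
        continuous_on_Re continuous_on_of_real)
  show "continuous_on S (\<lambda>x. profile2 a \<epsilon> d e (c x) (h x))"
    unfolding profile2_def powr_deriv1_def powr_deriv2_def w_def[symmetric] unfolding Complex_eq
    by (intro powc r1 r2 assms(1,2) continuous_on_add continuous_on_mult continuous_on_const
        continuous_on_Re continuous_on_of_real)
qed

text \<open>The second derivative is quadratic in the direction. This is what turns a dilation of the
  coordinates into the coefficients of \<open>A\<close>.\<close>

lemma profile2_scale:
  "profile2 a \<epsilon> (s *\<^sub>R d) (s * e) \<zeta> z = s\<^sup>2 * profile2 a \<epsilon> d e \<zeta> z"
proof -
  have r1: "rad1 (s *\<^sub>R d) \<zeta> = s * rad1 d \<zeta>" by (simp add: rad1_def algebra_simps)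
  have r2: "rad2 (s *\<^sub>R d) \<zeta> = s\<^sup>2 * rad2 d \<zeta>" by (simp add: rad2_def r1 power_mult_distrib algebra_simps)
  have c: "Complex (s * x) (s * y) = s *\<^sub>R Complex x y" for x y by (simp add: complex_eq_iff)
  have p1: "powr_deriv1 t (s *\<^sub>R d) \<zeta> = s *\<^sub>R powr_deriv1 t d \<zeta>" for t d \<zeta> by (simp add: powr_deriv1_def)
  have p2: "powr_deriv2 t (s *\<^sub>R d) (complex_of_real (s\<^sup>2 * x)) \<zeta> = s\<^sup>2 *\<^sub>R powr_deriv2 t d (complex_of_real x) \<zeta>" for t d x \<zeta>
    by (simp add: powr_deriv2_def scaleR_conv_of_real power2_eq_square algebra_simps)
  have p3: "powr_deriv2 t (s *\<^sub>R d) 0 \<zeta> = s\<^sup>2 *\<^sub>R powr_deriv2 t d 0 \<zeta>" for t d \<zeta>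
    using p2[of t d 0] by simp
  show ?thesis unfolding profile2_def r1 r2 c p1 p2 p3 by (simp add: power2_eq_square algebra_simps)
qed

lemma profile2_planar: "profile2 a 0 1 0 \<zeta> z + profile2 a 0 \<i> 0 \<zeta> z = 0"
  by (simp add: profile2_def powr_deriv2_def)

text \<open>Write the second summand as \<open>s f\<close> with \<open>s = Re (\<zeta>\<^sup>-\<^sup>1\<^sup>/\<^sup>2)\<close>. Then \<open>s\<close> is harmonic in the plane, and the
  Laplacian of \<open>f(\<bar>\<zeta>\<bar>, z)\<close> is \<open>f\<^sub>r\<^sub>r + f\<^sub>r / r + f\<^sub>z\<^sub>z = f\<^sub>r / r\<close>. Because \<open>s\<close> is homogeneous of degree
  \<open>-1/2\<close>, its radial derivative is \<open>- s / (2 r)\<close>, and the mixed term \<open>2 \<nabla>s \<cdot> \<nabla>f = - s f\<^sub>r / r\<close>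
  cancels the remaining one.\<close>

lemma profile2_laplace:
  assumes "\<zeta> \<noteq> 0"
  shows "profile2 a \<epsilon> 1 0 \<zeta> z + profile2 a \<epsilon> \<i> 0 \<zeta> z + profile2 a \<epsilon> 0 1 \<zeta> z = 0"
proof -
  define r x y where "r = cmod \<zeta>" and "x = Re \<zeta>" and "y = Im \<zeta>"
  have r: "r > 0" using assms by (simp add: r_def)
  have rr: "x\<^sup>2 + y\<^sup>2 = r\<^sup>2" by (simp add: r_def x_def y_def cmod_power2)
  define p where "p = complex_of_real (a + 1 / 2)"
  define w where "w = Complex r z"
  define B where "B = Re (p * (p - 1) * w powr (p - 2))"
  define C where "C = Re (p * w powr (p - 1))"
  define S where "S = - (1 / 2) * \<zeta> powr (- 3 / 2)"
  define s where "s = Re (\<zeta> powr (- 1 / 2))"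
  \<comment> \<open>Euler's relation for the homogeneous function \<open>s\<close>.\<close>
  have S: "Re S * x - Im S * y = - s / 2"
  proof -
    have "\<zeta> powr (- 3 / 2) * \<zeta> = \<zeta> powr (- 1 / 2)" using powr_add[of \<zeta> "- 3 / 2" 1] by simp
    then have "S * \<zeta> = - (1 / 2) * \<zeta> powr (- 1 / 2)" by (simp add: S_def mult.assoc)
    then have "Re (S * \<zeta>) = - s / 2" by (simp add: s_def)
    then show ?thesis by (simp add: x_def y_def)
  qed
  have rd: "rad1 1 \<zeta> = x / r" "rad1 \<i> \<zeta> = y / r" "rad1 0 \<zeta> = 0"
    "rad2 1 \<zeta> = (1 - (x / r)\<^sup>2) / r" "rad2 \<i> \<zeta> = (1 - (y / r)\<^sup>2) / r" "rad2 0 \<zeta> = 0"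
    by (simp_all add: rad1_def rad2_def r_def x_def y_def)
  have pS: "Re (powr_deriv1 (- 1 / 2) 1 \<zeta>) = Re S" "Re (powr_deriv1 (- 1 / 2) \<i> \<zeta>) = - Im S" "Re (powr_deriv1 (- 1 / 2) 0 \<zeta>) = 0"
    by (simp_all add: powr_deriv1_def S_def)
  have pw: "Re (powr_deriv1 (a + 1 / 2) (Complex t 0) w) = C * t" for t
    by (simp add: powr_deriv1_def C_def p_def Complex_eq)
  have pww: "Re (powr_deriv2 (a + 1 / 2) (Complex t 0) (complex_of_real q) w) = B * t\<^sup>2 + C * q" for t q
  proof -
    have "powr_deriv2 (a + 1 / 2) (Complex t 0) (complex_of_real q) w =
        complex_of_real (t\<^sup>2) * (p * (p - 1) * w powr (p - 2)) + complex_of_real q * (p * w powr (p - 1))"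
      by (simp add: powr_deriv2_def p_def Complex_eq power2_eq_square algebra_simps)
    then show ?thesis by (simp add: B_def C_def)
  qed
  have pwe: "Re (powr_deriv2 (a + 1 / 2) (Complex 0 1) (complex_of_real 0) w) = - B"
  proof -
    have "powr_deriv2 (a + 1 / 2) (Complex 0 1) (complex_of_real 0) w = - (p * (p - 1) * w powr (p - 2))"
      unfolding powr_deriv2_def p_def[symmetric] by (simp add: Complex_eq algebra_simps)
    then show ?thesis by (simp add: B_def)
  qed
  have pl: "Re (powr_deriv2 t 1 0 \<zeta>) + Re (powr_deriv2 t \<i> 0 \<zeta>) = 0" "Re (powr_deriv2 t 0 0 \<zeta>) = 0" for t
    by (simp_all add: powr_deriv2_def)
  have "profile2 a \<epsilon> 1 0 \<zeta> z + profile2 a \<epsilon> \<i> 0 \<zeta> z + profile2 a \<epsilon> 0 1 \<zeta> z =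
     \<epsilon> * (2 * (Re S * (C * (x / r)) - Im S * (C * (y / r))) +
       s * (B * (x / r)\<^sup>2 + C * ((1 - (x / r)\<^sup>2) / r) + (B * (y / r)\<^sup>2 + C * ((1 - (y / r)\<^sup>2) / r)) - B))"
  proof -
    have i: "Re (powr_deriv2 t \<i> 0 \<zeta>) = - Re (powr_deriv2 t 1 0 \<zeta>)" for t using pl(1)[of t] by simp
    have e: "Complex 0 0 = 0" by (simp add: complex_eq_iff)
    show ?thesis unfolding profile2_def r_def[symmetric] w_def[symmetric] rd pw pww pwe pS i pl(2)
      by (simp add: s_def algebra_simps)
  qed
  also have "\<dots> = 0"
  proof -
    have "2 * (Re S * (C * (x / r)) - Im S * (C * (y / r))) = 2 * C / r * (Re S * x - Im S * y)"
      using r by (simp add: field_simps)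
    also have "\<dots> = - (C * s / r)" by (simp add: S)
    finally have 1: "2 * (Re S * (C * (x / r)) - Im S * (C * (y / r))) = - (C * s / r)" .
    have xy: "(x / r)\<^sup>2 + (y / r)\<^sup>2 = 1" using r rr by (simp add: power_divide flip: add_divide_distrib)
    have "B * (x / r)\<^sup>2 + C * ((1 - (x / r)\<^sup>2) / r) + (B * (y / r)\<^sup>2 + C * ((1 - (y / r)\<^sup>2) / r)) - B =
       B * ((x / r)\<^sup>2 + (y / r)\<^sup>2) + C / r * (2 - ((x / r)\<^sup>2 + (y / r)\<^sup>2)) - B"
      using r by (simp add: field_simps)
    also have "\<dots> = C / r" unfolding xy by simp
    finally show ?thesis unfolding 1 by simp
  qed
  finally show ?thesis .
qed

section \<open>Solutions supported in cones\<close>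

text \<open>The bracket of the profile with the latitude factor replaced by its maximum \<open>1\<close>. The angle is
  expressed by \<open>arccos\<close>, which gives its absolute value and, unlike \<^const>\<open>Arg\<close>, is
  continuous across the negative real axis.\<close>

definition planar_bound :: "real \<Rightarrow> real \<Rightarrow> complex \<Rightarrow> real" where
  "planar_bound a \<epsilon> \<zeta> = cos (a * arccos (Re \<zeta> / cmod \<zeta>)) + \<epsilon> * cos (arccos (Re \<zeta> / cmod \<zeta>) / 2)"

lemma Re_eq_cmod_cos_Arg: "Re \<zeta> = cmod \<zeta> * cos (Arg \<zeta>)"
  by (cases "\<zeta> = 0") (use Arg_eq[of \<zeta>] in \<open>auto simp: Re_exp dest!: arg_cong[where f = Re]\<close>)

lemma arccos_Arg:
  assumes "\<zeta> \<noteq> 0"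
  shows "arccos (Re \<zeta> / cmod \<zeta>) = \<bar>Arg \<zeta>\<bar>"
proof -
  have "Re \<zeta> / cmod \<zeta> = cos \<bar>Arg \<zeta>\<bar>" using assms Re_eq_cmod_cos_Arg[of \<zeta>] by (simp add: field_simps)
  moreover have "0 \<le> \<bar>Arg \<zeta>\<bar>" "\<bar>Arg \<zeta>\<bar> \<le> pi" using mpi_less_Arg[of \<zeta>] Arg_le_pi[of \<zeta>] by auto
  ultimately show ?thesis using arccos_cos[of "\<bar>Arg \<zeta>\<bar>"] by (simp only:)
qed

lemma planar_bound_Arg:
  assumes "\<zeta> \<noteq> 0"
  shows "planar_bound a \<epsilon> \<zeta> = cos (a * Arg \<zeta>) + \<epsilon> * cos (Arg \<zeta> / 2)"
proof -
  have "cos (s * \<bar>t\<bar>) = cos (s * t)" "cos (\<bar>t\<bar> / 2) = cos (t / 2)" for s t :: real by (simp_all add: abs_if)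
  then show ?thesis unfolding planar_bound_def arccos_Arg[OF assms] by simp
qed

lemma isCont_planar_bound:
  assumes "\<zeta> \<noteq> 0"
  shows "isCont (planar_bound a \<epsilon>) \<zeta>"
proof -
  have "continuous_on (- {0}) (\<lambda>\<zeta>. Re \<zeta> / cmod \<zeta>)" by (intro continuous_intros) auto
  moreover have "- 1 \<le> Re \<zeta> / cmod \<zeta> \<and> Re \<zeta> / cmod \<zeta> \<le> 1" for \<zeta>
    using abs_Re_le_cmod[of \<zeta>] by (cases "\<zeta> = 0") (auto simp: field_simps abs_le_iff)
  moreover define A where "A \<zeta> = arccos (Re \<zeta> / cmod \<zeta>)" for \<zeta>
  ultimately have "continuous_on (- {0}) A" unfolding A_def by (intro continuous_on_arccos) auto
  then have "continuous_on (- {0}) (planar_bound a \<epsilon>)"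
    unfolding planar_bound_def A_def[symmetric] by (intro continuous_intros) auto
  then show ?thesis using assms by (subst (asm) continuous_on_eq_continuous_at) auto
qed

lemma planar_bound_le: "0 \<le> \<epsilon> \<Longrightarrow> planar_bound a \<epsilon> \<zeta> \<le> 1 + \<epsilon>"
  unfolding planar_bound_def by (intro add_mono mult_left_le) auto

lemma profile_le_planar_bound:
  assumes "1 / 2 < a" "a < 3 / 2" "0 \<le> \<epsilon>"
  shows "profile a \<epsilon> \<zeta> z \<le> cmod \<zeta> powr a * planar_bound a \<epsilon> \<zeta>"
  using profile_upper[OF assms, of \<zeta> z] by (cases "\<zeta> = 0") (simp_all add: planar_bound_Arg)

text \<open>Off the cut the profile is smooth. On the axis \<open>\<zeta> = 0\<close> the positive part is squeezed by
  \<open>(1 + \<epsilon>) r\<^sup>a\<close>, although the profile itself may tend to \<open>-\<infinity>\<close> there. At the other points of the cut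
  the planar bound is negative, hence also nearby, and the positive part vanishes in a
  neighbourhood.\<close>

lemma isCont_positive_profile:
  fixes c :: "'a::t2_space \<Rightarrow> complex"
  assumes a: "1 / 2 < a" "a < 3 / 2" and \<epsilon>: "0 \<le> \<epsilon>"
    and c: "continuous_on UNIV c" and h: "continuous_on UNIV h"
  shows "isCont (\<lambda>x. max 0 (profile a \<epsilon> (c x) (h x))) x"
proof (cases "c x \<in> \<real>\<^sub>\<le>\<^sub>0")
  case False
  have "open (c -` (- \<real>\<^sub>\<le>\<^sub>0))" by (intro open_vimage c) auto
  moreover have "continuous_on (c -` (- \<real>\<^sub>\<le>\<^sub>0)) (\<lambda>x. max 0 (profile a \<epsilon> (c x) (h x)))"
    by (intro continuous_on_max continuous_on_const continuous_on_profile)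
       (auto intro: continuous_on_subset[OF c] continuous_on_subset[OF h])
  moreover have "x \<in> c -` (- \<real>\<^sub>\<le>\<^sub>0)" using False by simp
  ultimately show ?thesis by (simp add: continuous_on_eq_continuous_at)
next
  case True
  have cx: "isCont c x" using c by (simp add: continuous_on_eq_continuous_at)
  have zero: "max 0 (profile a \<epsilon> (c x) (h x)) = 0"
    using profile_pos_imp(1)[OF a \<epsilon>, of "c x" "h x"] True by fastforce
  show ?thesis
  proof (cases "c x = 0")
    case True
    have "((\<lambda>y. max 0 (profile a \<epsilon> (c y) (h y))) \<longlongrightarrow> 0) (at x)"
    proof (rule Lim_null_comparison)
      show "((\<lambda>y. cmod (c y) powr a * (1 + \<epsilon>)) \<longlongrightarrow> 0) (at x)"
      proof -
        have "((\<lambda>y. cmod (c y)) \<longlongrightarrow> 0) (at x)" using cx True unfolding isCont_def by (auto intro: tendsto_norm_zero)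
        then have "((\<lambda>y. cmod (c y) powr a) \<longlongrightarrow> 0) (at x)"
          using a by (intro tendsto_zero_powrI[where b = a]) auto
        then show ?thesis by (rule tendsto_mult_left_zero)
      qed
      show "\<forall>\<^sub>F y in at x. norm (max 0 (profile a \<epsilon> (c y) (h y))) \<le> cmod (c y) powr a * (1 + \<epsilon>)"
      proof (rule always_eventually, rule allI)
        fix y
        have "profile a \<epsilon> (c y) (h y) \<le> cmod (c y) powr a * (1 + \<epsilon>)"
          by (rule order_trans[OF profile_le_planar_bound[OF a \<epsilon>]]) (intro mult_left_mono planar_bound_le \<epsilon>, simp)
        then show "norm (max 0 (profile a \<epsilon> (c y) (h y))) \<le> cmod (c y) powr a * (1 + \<epsilon>)" using \<epsilon> by simp
      qed
    qed
    then show ?thesis unfolding isCont_def zero .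
  next
    case False
    have "Arg (c x) = pi" using False True by (auto simp: Arg_eq_pi complex_nonpos_Reals_iff complex_eq_iff)
    moreover have "cos (pi - a * pi) > 0" using a by (intro cos_gt_zero_pi) (auto simp: field_simps)
    ultimately have "planar_bound a \<epsilon> (c x) < 0" by (simp add: planar_bound_Arg[OF False] cos_diff)
    moreover have "isCont (\<lambda>y. planar_bound a \<epsilon> (c y)) x"
      using isCont_o2[OF cx isCont_planar_bound[OF False]] .
    ultimately have "\<forall>\<^sub>F y in at x. planar_bound a \<epsilon> (c y) < 0"
      unfolding isCont_def by (rule order_tendstoD(2)[rotated])
    then have "\<forall>\<^sub>F y in at x. max 0 (profile a \<epsilon> (c y) (h y)) = 0"
    proof eventually_elim
      case (elim y)
      then have "cmod (c y) powr a * planar_bound a \<epsilon> (c y) \<le> 0" by (intro mult_nonneg_nonpos) auto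
      then show ?case using profile_le_planar_bound[OF a \<epsilon>, of "c y" "h y"] by simp
    qed
    then have "((\<lambda>y. max 0 (profile a \<epsilon> (c y) (h y))) \<longlongrightarrow> 0) (at x)" by (rule tendsto_eventually)
    then show ?thesis unfolding isCont_def zero .
  qed
qed

text \<open>Linear embeddings of the coordinates \<open>\<zeta>\<close> and \<open>z\<close>, given by the images of the unit vectors. The
  remaining axes are sent to \<open>0\<close>.\<close>

definition clin :: "('n \<Rightarrow> complex) \<Rightarrow> real^'n::finite \<Rightarrow> complex" where
  "clin d x = (\<Sum>m\<in>UNIV. x $ m *\<^sub>R d m)"

definition rlin :: "('n \<Rightarrow> real) \<Rightarrow> real^'n::finite \<Rightarrow> real" where
  "rlin e x = (\<Sum>m\<in>UNIV. x $ m * e m)"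

definition cone_solution :: "real \<Rightarrow> real \<Rightarrow> ('n \<Rightarrow> complex) \<Rightarrow> ('n \<Rightarrow> real) \<Rightarrow> real^'n::finite \<Rightarrow> real" where
  "cone_solution a \<epsilon> d e x = max 0 (profile a \<epsilon> (clin d x) (rlin e x))"

lemma lin_along_axis:
  "clin d (x + t *\<^sub>R axis m 1) = clin d x + t *\<^sub>R d m" "rlin e (x + t *\<^sub>R axis m 1) = rlin e x + t * e m"
proof -
  have "clin d (x + t *\<^sub>R axis m 1) = clin d x + (\<Sum>k\<in>UNIV. if k = m then t *\<^sub>R d m else 0)"
    unfolding clin_def sum.distrib[symmetric]
    by (intro sum.cong refl) (auto simp: axis_def algebra_simps)
  then show "clin d (x + t *\<^sub>R axis m 1) = clin d x + t *\<^sub>R d m" by simp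
  have "rlin e (x + t *\<^sub>R axis m 1) = rlin e x + (\<Sum>k\<in>UNIV. if k = m then t * e m else 0)"
    unfolding rlin_def sum.distrib[symmetric]
    by (intro sum.cong refl) (auto simp: axis_def algebra_simps)
  then show "rlin e (x + t *\<^sub>R axis m 1) = rlin e x + t * e m" by simp
qed

lemma continuous_on_lin: "continuous_on UNIV (clin d)" "continuous_on UNIV (rlin e)"
  unfolding clin_def rlin_def by (intro continuous_intros)+

lemma cone_solution_homogeneous:
  fixes d :: "'n::finite \<Rightarrow> complex"
  shows "homogeneous_of_degree a (cone_solution a \<epsilon> d e)"
  unfolding homogeneous_of_degree_def
proof (intro allI impI)
  fix t :: real and x :: "real^'n" assume t: "t > 0"
  have "clin d (t *\<^sub>R x) = t *\<^sub>R clin d x" "rlin e (t *\<^sub>R x) = t * rlin e x"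
    by (simp_all add: clin_def rlin_def scaleR_sum_right sum_distrib_left mult.assoc)
  then show "cone_solution a \<epsilon> d e (t *\<^sub>R x) = t powr a * cone_solution a \<epsilon> d e x"
    using t by (simp add: cone_solution_def profile_homogeneous max_mult_distrib_left)
qed

text \<open>The equation need only hold for the profile as a function of \<open>(\<zeta>, z)\<close>, with the axes entering
  through their images under the embedding.\<close>

lemma positive_solution_cone_solution:
  fixes d :: "'n::finite \<Rightarrow> complex"
  assumes a: "1 / 2 < a" "a < 3 / 2" and \<epsilon>: "0 \<le> \<epsilon>" and w: "\<And>m. 0 < w m"
    and eq: "\<And>\<zeta> z. \<zeta> \<noteq> 0 \<Longrightarrow> (\<Sum>m\<in>UNIV. w m * profile2 a \<epsilon> (d m) (e m) \<zeta> z) = 0"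
  shows "positive_solution (cone_solution a \<epsilon> d e) w
      (\<lambda>m x. profile1 a \<epsilon> (d m) (e m) (clin d x) (rlin e x))
      (\<lambda>m x. profile2 a \<epsilon> (d m) (e m) (clin d x) (rlin e x))"
proof
  show cont: "continuous_on UNIV (cone_solution a \<epsilon> d e)"
    unfolding cone_solution_def using isCont_positive_profile[OF a \<epsilon> continuous_on_lin]
    by (intro continuous_at_imp_continuous_on ballI)
  show "0 \<le> cone_solution a \<epsilon> d e x" for x by (simp add: cone_solution_def)
  show "0 < w m" for m by (rule w)
  have pos: "clin d x \<notin> \<real>\<^sub>\<le>\<^sub>0" if "0 < cone_solution a \<epsilon> d e x" for x
    using profile_pos_imp(1)[OF a \<epsilon>] that by (simp add: cone_solution_def less_max_iff_disj)
  show "(\<Sum>m\<in>UNIV. w m * profile2 a \<epsilon> (d m) (e m) (clin d x) (rlin e x)) = 0" if "0 < cone_solution a \<epsilon> d e x" for x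
    using pos[OF that] by (intro eq) auto
  show "continuous_on {x. 0 < cone_solution a \<epsilon> d e x} (\<lambda>x. profile1 a \<epsilon> (d m) (e m) (clin d x) (rlin e x))"
    "continuous_on {x. 0 < cone_solution a \<epsilon> d e x} (\<lambda>x. profile2 a \<epsilon> (d m) (e m) (clin d x) (rlin e x))" for m
    using pos by (auto intro!: continuous_on_profile continuous_on_subset[OF continuous_on_lin(1)]
        continuous_on_subset[OF continuous_on_lin(2)])
  fix m x assume x: "0 < cone_solution a \<epsilon> d e x"
  have "eventually (\<lambda>t. x + t *\<^sub>R axis m 1 \<in> {x. 0 < cone_solution a \<epsilon> d e x}) (nhds 0)"
    using cont x by (intro eventually_along_line open_Collect_less) auto
  then have ev: "eventually (\<lambda>t. cone_solution a \<epsilon> d e (x + t *\<^sub>R axis m 1) =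
      profile a \<epsilon> (clin d x + t *\<^sub>R d m) (rlin e x + t * e m)) (nhds 0)"
    by eventually_elim (auto simp: cone_solution_def lin_along_axis)
  show "((\<lambda>t. cone_solution a \<epsilon> d e (x + t *\<^sub>R axis m 1)) has_real_derivative
      profile1 a \<epsilon> (d m) (e m) (clin d x) (rlin e x)) (at 0)"
    using DERIV_profile(1)[OF pos[OF x]] by (subst DERIV_cong_ev[OF refl ev refl])
  show "((\<lambda>t. profile1 a \<epsilon> (d m) (e m) (clin d (x + t *\<^sub>R axis m 1)) (rlin e (x + t *\<^sub>R axis m 1)))
      has_real_derivative profile2 a \<epsilon> (d m) (e m) (clin d x) (rlin e x)) (at 0)"
    unfolding lin_along_axis by (rule DERIV_profile(2)[OF pos[OF x]])
qed

section \<open>Where the harmonic profiles are positive\<close>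

lemma latitude_factor_tan:
  assumes "- pi / 2 < \<omega>" "\<omega> < pi / 2"
  shows "latitude_factor p (tan \<omega>) = cos \<omega> powr (- p) * cos (p * \<omega>)"
proof -
  have c: "cos \<omega> > 0" using assms by (intro cos_gt_zero_pi) auto
  have eq: "complex_of_real (1 / cos \<omega>) * exp (\<i> * complex_of_real \<omega>) = Complex 1 (tan \<omega>)"
    using c by (simp add: complex_eq_iff tan_def Re_exp Im_exp)
  have A: "Arg (Complex 1 (tan \<omega>)) = \<omega>"
    by (rule Arg_unique[OF eq]) (use assms c in auto)
  have "cmod (Complex 1 (tan \<omega>)) = 1 / cos \<omega>"
    unfolding eq[symmetric] norm_mult norm_of_real norm_exp_i_times using c by simp
  moreover have "Complex 1 (tan \<omega>) \<noteq> 0" by (simp add: complex_eq_iff)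
  ultimately have "latitude_factor p (tan \<omega>) = (1 / cos \<omega>) powr p * cos (p * \<omega>)"
    unfolding latitude_factor_def by (metis A Re_powr_polar(1))
  also have "(1 / cos \<omega>) powr p = cos \<omega> powr (- p)" using c by (simp add: powr_minus powr_divide inverse_eq_divide)
  finally show ?thesis .
qed

lemma Re_gt_of_Arg:
  assumes "\<zeta> \<noteq> 0" "\<bar>Arg \<zeta>\<bar> < \<beta>" "\<beta> \<le> pi"
  shows "cmod \<zeta> * cos \<beta> < Re \<zeta>"
proof -
  have "cos \<beta> < cos \<bar>Arg \<zeta>\<bar>" using assms by (intro cos_monotone_0_pi) auto
  then have "cos \<beta> < cos (Arg \<zeta>)" by simp
  then have "cmod \<zeta> * cos \<beta> < cmod \<zeta> * cos (Arg \<zeta>)" using assms(1) by (intro mult_strict_left_mono) auto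
  then show ?thesis by (simp only: Re_eq_cmod_cos_Arg[symmetric])
qed

text \<open>Since the latitude factor is at most \<open>1\<close>, positivity forces \<open>cos (a \<phi>) + \<epsilon> cos (\<phi>/2) > 0\<close>, which
  bounds the longitude. For slopes beyond \<open>\<tau>\<close> the second term is at most \<open>-1\<close> on these longitudes and
  outweighs the cosine.\<close>

lemma profile_support:
  assumes a: "1 / 2 < a" "a < 1" and \<epsilon>: "0 \<le> \<epsilon>" and \<beta>: "0 \<le> \<beta>" "\<beta> \<le> pi"
    and planar: "cos (a * \<beta>) + \<epsilon> * cos (\<beta> / 2) \<le> 0"
    and \<tau>: "0 \<le> \<tau>" "\<epsilon> * cos (\<beta> / 2) * latitude_factor (a + 1 / 2) \<tau> \<le> - 1"
    and pos: "0 < profile a \<epsilon> \<zeta> z"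
  shows "cmod \<zeta> * cos \<beta> < Re \<zeta>" "\<bar>z\<bar> < \<tau> * cmod \<zeta>"
proof -
  have a': "a < 3 / 2" using a by simp
  note imp = profile_pos_imp[OF a(1) a' \<epsilon> pos]
  have nz: "\<zeta> \<noteq> 0" using imp(1) by auto
  define \<phi> where "\<phi> = \<bar>Arg \<zeta>\<bar>"
  have \<phi>: "0 \<le> \<phi>" "\<phi> \<le> pi" using mpi_less_Arg[of \<zeta>] Arg_le_pi[of \<zeta>] by (auto simp: \<phi>_def)
  have ev: "cos (s * Arg \<zeta>) = cos (s * \<phi>)" "cos (Arg \<zeta> / 2) = cos (\<phi> / 2)" for s
    by (simp_all add: \<phi>_def abs_if)
  have lt: "\<phi> < \<beta>"
  proof (rule ccontr)
    assume "\<not> \<phi> < \<beta>"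
    then have "\<beta> \<le> \<phi>" by simp
    moreover have "a * \<phi> \<le> pi" using a \<phi> mult_mono[of a 1 \<phi> pi] by simp
    ultimately have "cos (a * \<phi>) \<le> cos (a * \<beta>)" "cos (\<phi> / 2) \<le> cos (\<beta> / 2)"
      using a \<beta> \<phi> by (auto intro!: cos_monotone_0_pi_le)
    then have "cos (a * \<phi>) + \<epsilon> * cos (\<phi> / 2) \<le> 0" using planar mult_left_mono[OF _ \<epsilon>, of "cos (\<phi> / 2)" "cos (\<beta> / 2)"] by linarith
    then show False using imp(3) unfolding ev by simp
  qed
  then show "cmod \<zeta> * cos \<beta> < Re \<zeta>" using nz \<beta> unfolding \<phi>_def by (intro Re_gt_of_Arg)
  show "\<bar>z\<bar> < \<tau> * cmod \<zeta>"
  proof (rule ccontr)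
    assume "\<not> \<bar>z\<bar> < \<tau> * cmod \<zeta>"
    then have "\<tau> \<le> \<bar>z / cmod \<zeta>\<bar>" using nz by (simp add: field_simps)
    then have "latitude_factor (a + 1 / 2) \<bar>z / cmod \<zeta>\<bar> \<le> latitude_factor (a + 1 / 2) \<tau>" using a \<tau> by (intro latitude_factor_antimono) auto
    then have l: "latitude_factor (a + 1 / 2) (z / cmod \<zeta>) \<le> latitude_factor (a + 1 / 2) \<tau>" by (simp only: latitude_factor_abs)
    have c: "0 \<le> cos (\<beta> / 2)" "cos (\<beta> / 2) \<le> cos (\<phi> / 2)"
      using lt \<phi> \<beta> by (auto intro!: cos_monotone_0_pi_le cos_ge_zero)
    have neg: "latitude_factor (a + 1 / 2) \<tau> \<le> 0"
    proof (rule ccontr)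
      assume "\<not> latitude_factor (a + 1 / 2) \<tau> \<le> 0"
      then have "0 \<le> \<epsilon> * cos (\<beta> / 2) * latitude_factor (a + 1 / 2) \<tau>" using \<epsilon> c by auto
      then show False using \<tau> by simp
    qed
    have "\<epsilon> * (cos (\<phi> / 2) * latitude_factor (a + 1 / 2) (z / cmod \<zeta>)) \<le> \<epsilon> * (cos (\<phi> / 2) * latitude_factor (a + 1 / 2) \<tau>)"
      using \<epsilon> c l by (intro mult_left_mono) auto
    also have "\<dots> \<le> \<epsilon> * (cos (\<beta> / 2) * latitude_factor (a + 1 / 2) \<tau>)"
      using \<epsilon> c neg by (intro mult_left_mono mult_right_mono_neg) auto
    also have "\<dots> \<le> - 1" using \<tau>(2) by (simp add: mult.assoc)
    finally have "cos (a * \<phi>) + \<epsilon> * (cos (\<phi> / 2) * latitude_factor (a + 1 / 2) (z / cmod \<zeta>)) \<le> 0"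
      using cos_le_one[of "a * \<phi>"] by linarith
    then show False using imp(2) unfolding ev by simp
  qed
qed

text \<open>With \<open>\<beta> = \<pi>/2 + \<mu>\<close> the degree is chosen such that \<open>a \<beta> = \<pi>/2 + \<mu>/2\<close>, which makes it less than \<open>1\<close>,
  and \<open>\<epsilon>\<close> such that \<open>\<beta>\<close> bounds the longitudes, that is \<open>\<epsilon> cos (\<beta>/2) = sin (\<mu>/2)\<close>. The slope
  \<open>\<tau> = cot (2\<mu>)\<close> is less than \<open>cot \<mu>\<close>. At that slope the latitude factor is of order \<open>- \<mu>\<^sup>-\<^sup>3\<^sup>/\<^sup>2\<close>, while
  \<open>\<epsilon>\<close> is only of order \<open>\<mu>\<close>, so a small \<open>\<mu>\<close> satisfies the requirement of the preceding lemma.\<close>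

lemma exists_narrow_profile:
  obtains a \<epsilon> \<mu> \<tau> :: real where "1 / 2 < a" "a < 1" "0 \<le> \<epsilon>" "0 < \<mu>" "\<mu> < pi / 2" "0 < \<tau>" "\<tau> * tan \<mu> < 1"
    "\<And>\<zeta> z. 0 < profile a \<epsilon> \<zeta> z \<Longrightarrow> - sin \<mu> * cmod \<zeta> < Re \<zeta> \<and> \<bar>z\<bar> < \<tau> * cmod \<zeta>"
proof -
  \<comment> \<open>Then \<open>sin (2 * \<mu>) \<le> 1 / 4096 = 8 powr - 4\<close>, which absorbs all constants in the estimate \<open>Sp\<close>.\<close>
  define \<mu> :: real where "\<mu> = 1 / 8192"
  define \<beta> where "\<beta> = pi / 2 + \<mu>"
  define a where "a = (pi / 2 + \<mu> / 2) / \<beta>"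
  define \<epsilon> where "\<epsilon> = sin (\<mu> / 2) / cos (\<beta> / 2)"
  define \<omega> where "\<omega> = pi / 2 - 2 * \<mu>"
  define p where "p = a + 1 / 2"
  have pi: "3 < pi" using pi_gt3 .
  have \<mu>: "0 < \<mu>" "\<mu> < pi / 4" "\<mu> \<le> pi / 42" using pi by (auto simp: \<mu>_def)
  have \<beta>: "0 < \<beta>" "\<beta> < pi" using \<mu> pi by (auto simp: \<beta>_def)
  have a1: "a < 1" using \<mu> \<beta> by (simp add: a_def \<beta>_def)
  have a34: "3 / 4 \<le> a" using \<mu> \<beta> by (simp add: a_def \<beta>_def field_simps)
  have p: "5 / 4 \<le> p" "p \<le> 3 / 2" using a1 a34 by (auto simp: p_def)
  have cb: "0 < cos (\<beta> / 2)" using \<beta> by (intro cos_gt_zero_pi) auto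
  have sm: "0 < sin (\<mu> / 2)" using \<mu> pi by (intro sin_gt_zero) auto
  have \<epsilon>: "0 \<le> \<epsilon>" using cb sm by (simp add: \<epsilon>_def)
  have \<epsilon>c: "\<epsilon> * cos (\<beta> / 2) = sin (\<mu> / 2)" using cb by (simp add: \<epsilon>_def)
  have "a * \<beta> = pi / 2 + \<mu> / 2" using \<beta> by (simp add: a_def)
  then have "cos (a * \<beta>) = - sin (\<mu> / 2)" by (simp add: cos_add)
  then have planar: "cos (a * \<beta>) + \<epsilon> * cos (\<beta> / 2) \<le> 0" using \<epsilon>c by simp
  have \<omega>: "0 < \<omega>" "\<omega> < pi / 2" using \<mu> by (auto simp: \<omega>_def)
  define S where "S = sin (2 * \<mu>)"
  have cS: "cos \<omega> = S" by (simp add: \<omega>_def S_def cos_diff)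
  have S: "0 < S" "S \<le> 1 / 4096" "S \<le> 4 * sin (\<mu> / 2)"
  proof -
    show "0 < S" unfolding S_def using \<mu> pi by (intro sin_gt_zero) auto
    show "S \<le> 1 / 4096" unfolding S_def using sin_x_le_x[of "2 * \<mu>"] \<mu> by (simp add: \<mu>_def)
    have "S = 2 * (2 * sin (\<mu> / 2) * cos (\<mu> / 2)) * cos \<mu>"
      using sin_double[of \<mu>] sin_double[of "\<mu> / 2"] by (simp add: S_def)
    also have "\<dots> = 4 * sin (\<mu> / 2) * (cos (\<mu> / 2) * cos \<mu>)" by simp
    also have "\<dots> \<le> 4 * sin (\<mu> / 2) * 1"
    proof (intro mult_left_mono)
      have "0 \<le> cos (\<mu> / 2)" "0 \<le> cos \<mu>" using \<mu> pi by (auto intro!: cos_ge_zero)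
      then show "cos (\<mu> / 2) * cos \<mu> \<le> 1" by (intro mult_le_one) auto
    qed (use sm in simp)
    finally show "S \<le> 4 * sin (\<mu> / 2)" by simp
  qed
  \<comment> \<open>In the limit \<open>\<mu> = 0\<close> the argument is \<open>3 \<pi> / 4\<close>; here it stays at least \<open>2 \<pi> / 3\<close>.\<close>
  have cp: "cos (p * \<omega>) \<le> - 1 / 2"
  proof -
    have "1 - a = (\<mu> / 2) / \<beta>" using \<beta> by (simp add: a_def \<beta>_def field_simps)
    also have "\<dots> \<le> (\<mu> / 2) / (pi / 2)" using \<mu> \<beta> by (intro divide_left_mono) (auto simp: \<beta>_def)
    finally have "(1 - a) * \<omega> \<le> (\<mu> / pi) * (pi / 2)" using \<omega> \<mu> a1 by (intro mult_mono) auto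
    then have "(1 - a) * \<omega> \<le> \<mu> / 2" by simp
    moreover have "p * \<omega> = 3 / 2 * \<omega> - (1 - a) * \<omega>" by (simp add: p_def algebra_simps)
    ultimately have "2 * pi / 3 \<le> p * \<omega>" using \<mu>(3) \<omega>_def by linarith
    moreover have "p * \<omega> \<le> (3 / 2) * (pi / 2)" using p \<omega> by (intro mult_mono) auto
    ultimately have "cos (p * \<omega>) \<le> cos (2 * pi / 3)" by (intro cos_monotone_0_pi_le) auto
    then show ?thesis by (simp add: cos_120)
  qed
  have Sp: "2 \<le> sin (\<mu> / 2) * S powr (- p)"
  proof -
    have "(8::real) = (1 / 4096) powr (- 1 / 4)"
    proof -
      have "(1 / 4096 :: real) = 8 powr (- 4)" by (simp add: powr_minus powr_numeral flip: powr_realpow)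
      then show ?thesis by (simp only: powr_powr) simp
    qed
    also have "\<dots> \<le> S powr (- 1 / 4)" using S by (intro powr_mono2') auto
    finally have "8 \<le> S powr (- 1 / 4)" .
    also have "S powr (- 1 / 4) = S * S powr (- 5 / 4)" using S powr_add[of S 1 "- 5 / 4"] by simp
    also have "\<dots> \<le> S * S powr (- p)" using S p by (intro mult_left_mono powr_mono') auto
    also have "\<dots> \<le> 4 * sin (\<mu> / 2) * S powr (- p)" using S by (intro mult_right_mono) auto
    finally show ?thesis by (simp add: mult.commute)
  qed
  have latitude_factor: "\<epsilon> * cos (\<beta> / 2) * latitude_factor (a + 1 / 2) (tan \<omega>) \<le> - 1"
  proof -
    have "latitude_factor (a + 1 / 2) (tan \<omega>) = S powr (- p) * cos (p * \<omega>)"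
      using latitude_factor_tan[of \<omega> p] \<omega> by (simp add: cS p_def)
    then have "\<epsilon> * cos (\<beta> / 2) * latitude_factor (a + 1 / 2) (tan \<omega>) = (sin (\<mu> / 2) * S powr (- p)) * cos (p * \<omega>)"
      by (simp add: \<epsilon>c mult.assoc)
    also have "\<dots> \<le> (sin (\<mu> / 2) * S powr (- p)) * (- 1 / 2)"
      using cp Sp by (intro mult_left_mono) auto
    also have "\<dots> \<le> - 1" using Sp by simp
    finally show ?thesis .
  qed
  have t\<omega>: "0 < tan \<omega>" using \<omega> by (intro tan_gt_zero) auto
  have t\<mu>: "0 < tan \<mu>" using \<mu> pi by (intro tan_gt_zero) auto
  have "tan \<omega> < tan (pi / 2 - \<mu>)" using \<mu> \<omega> by (intro tan_monotone) (auto simp: \<omega>_def)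
  also have "tan (pi / 2 - \<mu>) = inverse (tan \<mu>)" by (rule tan_cot)
  finally have "tan \<omega> * tan \<mu> < 1" using t\<mu> by (simp add: field_simps)
  moreover have "- sin \<mu> * cmod \<zeta> < Re \<zeta> \<and> \<bar>z\<bar> < tan \<omega> * cmod \<zeta>" if "0 < profile a \<epsilon> \<zeta> z" for \<zeta> z
  proof -
    have "cos \<beta> = - sin \<mu>" by (simp add: \<beta>_def cos_add)
    then show ?thesis
      using profile_support[OF _ a1 \<epsilon> _ _ planar _ latitude_factor that] a34 \<beta> t\<omega> by (simp add: mult.commute)
  qed
  ultimately show thesis
    using a34 a1 \<epsilon> \<mu> t\<omega> by (intro that[of a \<epsilon> \<mu> "tan \<omega>"]) auto
qed

text \<open>For a common point let \<open>x \<le> 0\<close>. The longitude bound of the first strip gives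
  \<open>\<bar>x\<bar> \<le> tan \<mu> \<bar>y\<bar>\<close>, and \<open>z\<close> is negligible for large \<open>K\<close>. So \<open>\<bar>y\<bar> < \<tau> \<bar>x\<bar>\<close> up to a small error
  by the slope bound of the second strip, which contradicts \<open>\<tau> tan \<mu> < 1\<close>. If \<open>x > 0\<close>, the longitude
  bound of the second strip makes \<open>\<bar>x\<bar>\<close>, and then also \<open>\<bar>y\<bar>\<close>, comparable to \<open>\<bar>z\<bar>\<close>, against the flatness
  of the first strip.\<close>

lemma crossed_cones_disjoint:
  fixes \<mu> \<tau> :: real
  assumes \<mu>: "0 < \<mu>" "\<mu> < pi / 2" and \<tau>: "0 < \<tau>" "\<tau> * tan \<mu> < 1"
  obtains K where "0 < K" "\<And>x y z. \<lbrakk>- sin \<mu> * sqrt (x\<^sup>2 + y\<^sup>2) < x; \<bar>K * z\<bar> < \<tau> * sqrt (x\<^sup>2 + y\<^sup>2);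
      - sin \<mu> * sqrt (x\<^sup>2 + z\<^sup>2) < - x; \<bar>y\<bar> < \<tau> * sqrt (x\<^sup>2 + z\<^sup>2)\<rbrakk> \<Longrightarrow> False"
proof -
  define q where "q = (tan \<mu>)\<^sup>2"
  define b where "b = 1 - \<tau>\<^sup>2 * q"
  \<comment> \<open>The two summands serve the cases \<open>x > 0\<close> and \<open>x \<le> 0\<close> below.\<close>
  define M where "M = \<tau>\<^sup>2 * (q + \<tau>\<^sup>2 * (1 + q)) + \<tau>\<^sup>2 * (\<tau>\<^sup>2 * (1 + q)) / b"
  have t: "0 < tan \<mu>" using \<mu> by (intro tan_gt_zero)
  then have q: "0 \<le> q" by (simp add: q_def)
  have "(\<tau> * tan \<mu>)\<^sup>2 < 1" using \<tau> t by (simp add: abs_square_less_1)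
  then have b: "0 < b" by (simp add: b_def q_def power_mult_distrib)
  have M0: "0 \<le> M" using q b by (simp add: M_def)
  define K where "K = 1 + M"
  have K: "0 < K" using M0 by (simp add: K_def)
  have "M < K * 1" by (simp add: K_def)
  also have "\<dots> \<le> K * K" using M0 by (intro mult_left_mono) (auto simp: K_def)
  finally have KM: "M < K\<^sup>2" by (simp add: power2_eq_square)
  have K1: "\<tau>\<^sup>2 * (q + \<tau>\<^sup>2 * (1 + q)) < K\<^sup>2"
  proof -
    have "0 \<le> \<tau>\<^sup>2 * (\<tau>\<^sup>2 * (1 + q)) / b" using q b by simp
    then show ?thesis using KM by (simp add: M_def)
  qed
  have K2: "\<tau>\<^sup>2 * (\<tau>\<^sup>2 * (1 + q)) < K\<^sup>2 * b"
  proof -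
    have "0 \<le> \<tau>\<^sup>2 * (q + \<tau>\<^sup>2 * (1 + q))" using q by simp
    then have "\<tau>\<^sup>2 * (\<tau>\<^sup>2 * (1 + q)) / b < K\<^sup>2" using KM by (simp add: M_def)
    then show ?thesis using b by (simp add: pos_divide_less_eq)
  qed
  have s: "0 < sin \<mu>" "0 < cos \<mu>" using \<mu> by (auto intro: sin_gt_zero cos_gt_zero)
  have wedge: "x\<^sup>2 \<le> q * y\<^sup>2" if "- sin \<mu> * sqrt (x\<^sup>2 + y\<^sup>2) < x" "x \<le> 0" for x y :: real
  proof -
    have "- x \<le> sin \<mu> * sqrt (x\<^sup>2 + y\<^sup>2)" using that by simp
    then have "(- x)\<^sup>2 \<le> (sin \<mu> * sqrt (x\<^sup>2 + y\<^sup>2))\<^sup>2" using that by (intro power_mono) auto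
    then have "x\<^sup>2 \<le> (sin \<mu>)\<^sup>2 * (x\<^sup>2 + y\<^sup>2)" by (simp add: power_mult_distrib)
    then have "x\<^sup>2 * (1 - (sin \<mu>)\<^sup>2) \<le> (sin \<mu>)\<^sup>2 * y\<^sup>2" by (simp add: algebra_simps)
    then have "x\<^sup>2 * (cos \<mu>)\<^sup>2 \<le> (sin \<mu>)\<^sup>2 * y\<^sup>2" by (simp add: cos_squared_eq)
    then show ?thesis using s by (simp add: q_def tan_def power_divide field_simps)
  qed
  have flat: "t\<^sup>2 \<le> \<tau>\<^sup>2 * (x\<^sup>2 + y\<^sup>2)" if "\<bar>t\<bar> < \<tau> * sqrt (x\<^sup>2 + y\<^sup>2)" for t x y :: real
  proof -
    have "\<bar>t\<bar>\<^sup>2 \<le> (\<tau> * sqrt (x\<^sup>2 + y\<^sup>2))\<^sup>2" using that by (intro power_mono) auto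
    then show ?thesis by (simp add: power_mult_distrib)
  qed
  show thesis
  proof (rule that[OF K])
    fix x y z
    assume A: "- sin \<mu> * sqrt (x\<^sup>2 + y\<^sup>2) < x" "\<bar>K * z\<bar> < \<tau> * sqrt (x\<^sup>2 + y\<^sup>2)"
      "- sin \<mu> * sqrt (x\<^sup>2 + z\<^sup>2) < - x" "\<bar>y\<bar> < \<tau> * sqrt (x\<^sup>2 + z\<^sup>2)"
    have fz: "K\<^sup>2 * z\<^sup>2 \<le> \<tau>\<^sup>2 * (x\<^sup>2 + y\<^sup>2)" using flat[OF A(2)] by (simp add: power_mult_distrib)
    have fy: "y\<^sup>2 \<le> \<tau>\<^sup>2 * (x\<^sup>2 + z\<^sup>2)" by (rule flat[OF A(4)])
    show False
    proof (cases "x \<le> 0")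
      case True
      have x: "x\<^sup>2 \<le> q * y\<^sup>2" by (rule wedge[OF A(1) True])
      have y: "0 < y\<^sup>2"
      proof (rule ccontr)
        assume "\<not> 0 < y\<^sup>2"
        then have "y = 0" by simp
        moreover from this x have "x = 0" by simp
        ultimately show False using A(1) by simp
      qed
      have "\<tau>\<^sup>2 * x\<^sup>2 \<le> \<tau>\<^sup>2 * (q * y\<^sup>2)" using x by (intro mult_left_mono) auto
      then have "b * y\<^sup>2 \<le> \<tau>\<^sup>2 * z\<^sup>2" using fy by (simp add: b_def algebra_simps)
      then have "K\<^sup>2 * (b * y\<^sup>2) \<le> K\<^sup>2 * (\<tau>\<^sup>2 * z\<^sup>2)" by (intro mult_left_mono) auto
      also have "\<dots> = \<tau>\<^sup>2 * (K\<^sup>2 * z\<^sup>2)" by simp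
      also have "\<dots> \<le> \<tau>\<^sup>2 * (\<tau>\<^sup>2 * (x\<^sup>2 + y\<^sup>2))" using fz by (intro mult_left_mono) auto
      also have "\<dots> \<le> \<tau>\<^sup>2 * (\<tau>\<^sup>2 * ((1 + q) * y\<^sup>2))" using x by (intro mult_left_mono) (auto simp: algebra_simps)
      also have "\<dots> = (\<tau>\<^sup>2 * (\<tau>\<^sup>2 * (1 + q))) * y\<^sup>2" by simp
      also have "\<dots> < (K\<^sup>2 * b) * y\<^sup>2" using K2 y by (intro mult_strict_right_mono)
      finally show False by simp
    next
      case False
      have x: "x\<^sup>2 \<le> q * z\<^sup>2" using wedge[of "- x" z] A(3) False by simp
      then have z: "0 < z\<^sup>2" using False by (cases "z = 0") auto
      have "\<tau>\<^sup>2 * (x\<^sup>2 + z\<^sup>2) \<le> \<tau>\<^sup>2 * ((1 + q) * z\<^sup>2)" using x by (intro mult_left_mono) (auto simp: algebra_simps)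
      then have "x\<^sup>2 + y\<^sup>2 \<le> (q + \<tau>\<^sup>2 * (1 + q)) * z\<^sup>2" using x fy by (simp add: algebra_simps)
      then have "\<tau>\<^sup>2 * (x\<^sup>2 + y\<^sup>2) \<le> \<tau>\<^sup>2 * ((q + \<tau>\<^sup>2 * (1 + q)) * z\<^sup>2)" by (intro mult_left_mono) auto
      with fz have "K\<^sup>2 * z\<^sup>2 \<le> (\<tau>\<^sup>2 * (q + \<tau>\<^sup>2 * (1 + q))) * z\<^sup>2" by simp
      also have "\<dots> < K\<^sup>2 * z\<^sup>2" using K1 z by (intro mult_strict_right_mono)
      finally show False by simp
    qed
  qed
qed

section \<open>Assembling the configurations\<close>

definition diag :: "('n::finite \<Rightarrow> real) \<Rightarrow> real^'n^'n" where
  "diag w = (\<chi> m l. if m = l then w m else 0)"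

lemma diag_mult: "(diag w *v x) $ m = w m * x $ m"
  by (simp add: diag_def matrix_vector_mult_def if_distrib if_distribR cong: if_cong)

lemma diag_properties:
  fixes w :: "'n::finite \<Rightarrow> real"
  assumes "\<And>m. 0 < w m"
  shows "diagonal_matrix (diag w)" "positive_definite (diag w)"
proof -
  show "diagonal_matrix (diag w)" by (simp add: diagonal_matrix_def diag_def)
  have "0 < x \<bullet> (diag w *v x)" if "x \<noteq> 0" for x :: "real^'n"
  proof -
    obtain m where m: "x $ m \<noteq> 0" using \<open>x \<noteq> 0\<close> by (auto simp: vec_eq_iff)
    have "x \<bullet> (diag w *v x) = (\<Sum>m\<in>UNIV. w m * (x $ m)\<^sup>2)"
      by (simp add: inner_vec_def diag_mult power2_eq_square mult_ac)
    also have "\<dots> > 0" using assms m by (intro sum_pos2[of _ m]) (auto simp: less_imp_le)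
    finally show ?thesis .
  qed
  moreover have "transpose (diag w) = diag w" by (auto simp: transpose_def diag_def vec_eq_iff)
  ultimately show "positive_definite (diag w)" by (simp add: positive_definite_def)
qed

lemma cone_solution_nontrivial:
  assumes "0 \<le> \<epsilon>" "s *\<^sub>R d m = 1" "s * e m = 0"
  shows "\<exists>x. cone_solution a \<epsilon> d e x \<noteq> 0"
proof
  let ?x = "s *\<^sub>R axis m 1"
  have "clin d 0 = 0" "rlin e 0 = 0" by (simp_all add: clin_def rlin_def)
  then have "clin d ?x = 1" "rlin e ?x = 0"
    using assms lin_along_axis(1)[of d 0 s m] lin_along_axis(2)[of e 0 s m] by auto
  moreover have "profile a \<epsilon> 1 0 = 1 + \<epsilon>" by (simp add: profile_polar latitude_factor_0)
  ultimately show "cone_solution a \<epsilon> d e ?x \<noteq> 0" using assms(1) by (simp add: cone_solution_def)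
qed

text \<open>What remains to be arranged: the two equations for the embedded profiles and the disjointness of
  their positivity sets. A direction along which \<open>\<zeta>\<close> is real and positive and \<open>z = 0\<close> shows that
  neither function is trivial.\<close>

lemma segregated_cone_solutions:
  fixes w :: "'n::finite \<Rightarrow> real"
  assumes a: "1 / 2 < a" "a < 3 / 2" and a': "1 / 2 < a'" "a' < 3 / 2" and sum: "a + a' < 2"
    and \<epsilon>: "0 \<le> \<epsilon>" and w: "\<And>m. 0 < w m"
    and eq: "\<And>\<zeta> z. \<zeta> \<noteq> 0 \<Longrightarrow> (\<Sum>m\<in>UNIV. w m * profile2 a \<epsilon> (d m) (e m) \<zeta> z) = 0"
    and eq': "\<And>\<zeta> z. \<zeta> \<noteq> 0 \<Longrightarrow> (\<Sum>m\<in>UNIV. profile2 a' \<epsilon> (d' m) (e' m) \<zeta> z) = 0"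
    and disj: "\<And>x. 0 < profile a \<epsilon> (clin d x) (rlin e x) \<Longrightarrow> 0 < profile a' \<epsilon> (clin d' x) (rlin e' x) \<Longrightarrow> False"
    and nt: "s *\<^sub>R d m = 1" "s * e m = 0" "s' *\<^sub>R d' m' = 1" "s' * e' m' = 0"
  shows "segregated_configuration (diag w) {x. 0 < cone_solution a \<epsilon> d e x} {x. 0 < cone_solution a' \<epsilon> d' e' x}
    (cone_solution a \<epsilon> d e) (cone_solution a' \<epsilon> d' e') a a'"
proof -
  interpret u: positive_solution "cone_solution a \<epsilon> d e" w
      "\<lambda>m x. profile1 a \<epsilon> (d m) (e m) (clin d x) (rlin e x)"
      "\<lambda>m x. profile2 a \<epsilon> (d m) (e m) (clin d x) (rlin e x)"
    by (rule positive_solution_cone_solution[OF a \<epsilon> w eq])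
  interpret v: positive_solution "cone_solution a' \<epsilon> d' e'" "\<lambda>_. 1"
      "\<lambda>m x. profile1 a' \<epsilon> (d' m) (e' m) (clin d' x) (rlin e' x)"
      "\<lambda>m x. profile2 a' \<epsilon> (d' m) (e' m) (clin d' x) (rlin e' x)"
    by (rule positive_solution_cone_solution[OF a' \<epsilon>]) (use eq' in auto)
  have cone: "dilation_cone {x. 0 < cone_solution b \<epsilon> f g x}" for b f and g :: "'n \<Rightarrow> real"
    using cone_solution_homogeneous[of b \<epsilon> f g] by (auto simp: dilation_cone_def homogeneous_of_degree_def)
  have "div_A_grad_zero_in {x. 0 < cone_solution a' \<epsilon> d' e' x} (mat 1) (cone_solution a' \<epsilon> d' e')"
    by (rule v.div_zero) simp
  then have lap: "laplacian_zero_in {x. 0 < cone_solution a' \<epsilon> d' e' x} (cone_solution a' \<epsilon> d' e')"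
    by (simp add: div_A_grad_zero_in_def laplacian_zero_in_def)
  have "div_A_grad_zero_in {x. 0 < cone_solution a \<epsilon> d e x} (diag w) (cone_solution a \<epsilon> d e)"
    by (rule u.div_zero) (rule diag_mult)
  moreover have "{x. 0 < cone_solution a \<epsilon> d e x} \<inter> {x. 0 < cone_solution a' \<epsilon> d' e' x} = {}"
    using disj by (auto simp: cone_solution_def less_max_iff_disj)
  ultimately show ?thesis
    unfolding segregated_configuration_def
    using diag_properties[OF w] u.open_pos v.open_pos u.nonneg v.nonneg u.H1_loc_u v.H1_loc_u u.cont v.cont
      cone cone_solution_homogeneous lap a a' sum
      cone_solution_nontrivial[where d = d and e = e, OF \<epsilon> nt(1,2)]
      cone_solution_nontrivial[where d = d' and e = e', OF \<epsilon> nt(3,4)] by auto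
qed

lemma profile2_zero_direction: "profile2 a \<epsilon> 0 0 \<zeta> z = 0"
  using profile2_scale[of a \<epsilon> 0 0 0 \<zeta> z] by simp

lemma sum_three:
  fixes f :: "'n::finite \<Rightarrow> 'b::comm_monoid_add"
  assumes "i \<noteq> j" "i \<noteq> k" "j \<noteq> k" "\<And>m. m \<noteq> i \<Longrightarrow> m \<noteq> j \<Longrightarrow> m \<noteq> k \<Longrightarrow> f m = 0"
  shows "(\<Sum>m\<in>UNIV. f m) = f i + f j + f k"
proof -
  have "(\<Sum>m\<in>UNIV. f m) = (\<Sum>m\<in>{i, j, k}. f m)"
    using assms(4) by (intro sum.mono_neutral_right) auto
  then show ?thesis using assms by (simp add: add.assoc)
qed

lemma sum_two:
  fixes f :: "'n::finite \<Rightarrow> 'b::comm_monoid_add"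
  assumes "i \<noteq> j" "\<And>m. m \<noteq> i \<Longrightarrow> m \<noteq> j \<Longrightarrow> f m = 0"
  shows "(\<Sum>m\<in>UNIV. f m) = f i + f j"
proof -
  have "(\<Sum>m\<in>UNIV. f m) = (\<Sum>m\<in>{i, j}. f m)"
    using assms(2) by (intro sum.mono_neutral_right) auto
  then show ?thesis using assms by simp
qed

text \<open>The embedding \<open>\<zeta> = s x\<^sub>i + i L x\<^sub>j\<close>; together with \<open>axial_dir\<close>, which gives \<open>z = K x\<^sub>k\<close>, it
  describes all the coordinates that are used. The sign \<open>s\<close> selects the direction that the sector faces.\<close>

definition planar_dir :: "'n \<Rightarrow> 'n \<Rightarrow> real \<Rightarrow> real \<Rightarrow> 'n \<Rightarrow> complex" where
  "planar_dir i j s L m = (if m = i then complex_of_real s else if m = j then L *\<^sub>R \<i> else 0)"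

definition axial_dir :: "'n \<Rightarrow> real \<Rightarrow> 'n \<Rightarrow> real" where
  "axial_dir k K m = (if m = k then K else 0)"

lemma lin_dir:
  fixes i j k :: "'n::finite"
  assumes "i \<noteq> j"
  shows "clin (planar_dir i j s L) x = Complex (s * x $ i) (L * x $ j)" "rlin (axial_dir k K) x = K * x $ k"
proof -
  show "clin (planar_dir i j s L) x = Complex (s * x $ i) (L * x $ j)"
    unfolding clin_def using assms by (subst sum_two[OF assms]) (auto simp: planar_dir_def complex_eq_iff)
  have "rlin (axial_dir k K) x = (\<Sum>m\<in>UNIV. if m = k then K * x $ k else 0)"
    unfolding rlin_def axial_dir_def by (intro sum.cong) auto
  then show "rlin (axial_dir k K) x = K * x $ k" by simp
qed

lemma sign_direction:
  assumes "s\<^sup>2 = 1"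
  shows "profile2 a \<epsilon> (complex_of_real s) 0 \<zeta> z = profile2 a \<epsilon> 1 0 \<zeta> z"
  using profile2_scale[of a \<epsilon> s 1 0 \<zeta> z] assms by (simp add: scaleR_conv_of_real)

lemma spatial_equation:
  fixes i j k :: "'n::finite"
  assumes "i \<noteq> j" "i \<noteq> k" "j \<noteq> k" "s\<^sup>2 = 1" "K \<noteq> 0" "\<zeta> \<noteq> 0"
  shows "(\<Sum>m\<in>UNIV. (if m = k then 1 / K\<^sup>2 else 1) *
      profile2 a \<epsilon> (planar_dir i j s 1 m) (axial_dir k K m) \<zeta> z) = 0"
proof -
  have "(\<Sum>m\<in>UNIV. (if m = k then 1 / K\<^sup>2 else 1) *
      profile2 a \<epsilon> (planar_dir i j s 1 m) (axial_dir k K m) \<zeta> z) =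
      profile2 a \<epsilon> (complex_of_real s) 0 \<zeta> z + profile2 a \<epsilon> \<i> 0 \<zeta> z + 1 / K\<^sup>2 * profile2 a \<epsilon> 0 K \<zeta> z"
    using assms(1-3)
    by (subst sum_three[OF assms(1-3)]) (auto simp: planar_dir_def axial_dir_def profile2_zero_direction)
  also have "\<dots> = profile2 a \<epsilon> 1 0 \<zeta> z + profile2 a \<epsilon> \<i> 0 \<zeta> z + profile2 a \<epsilon> 0 1 \<zeta> z"
    using profile2_scale[of a \<epsilon> K 0 1 \<zeta> z] assms(4,5) by (simp add: sign_direction)
  also have "\<dots> = 0" by (rule profile2_laplace[OF assms(6)])
  finally show ?thesis .
qed

lemma planar_equation:
  fixes i j :: "'n::finite"
  assumes "i \<noteq> j" "s\<^sup>2 = 1" "L \<noteq> 0"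
  shows "(\<Sum>m\<in>UNIV. (if m = j then 1 / L\<^sup>2 else 1) * profile2 a 0 (planar_dir i j s L m) 0 \<zeta> z) = 0"
proof -
  have "(\<Sum>m\<in>UNIV. (if m = j then 1 / L\<^sup>2 else 1) * profile2 a 0 (planar_dir i j s L m) 0 \<zeta> z) =
      profile2 a 0 (complex_of_real s) 0 \<zeta> z + 1 / L\<^sup>2 * profile2 a 0 (L *\<^sub>R \<i>) 0 \<zeta> z"
    using assms(1)
    by (subst sum_two[OF assms(1)]) (auto simp: planar_dir_def profile2_zero_direction)
  also have "\<dots> = profile2 a 0 1 0 \<zeta> z + profile2 a 0 \<i> 0 \<zeta> z"
    using profile2_scale[of a 0 L \<i> 0 \<zeta> z] assms(2,3) by (simp add: sign_direction)
  finally show ?thesis by (simp add: profile2_planar)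
qed

text \<open>A planar sector of half-opening \<open>\<pi> / (2 a)\<close>; since \<open>a \<pi> < 3 \<pi> / 2\<close>, the cosine does not become
  positive again before the cut.\<close>

lemma planar_support:
  assumes a: "1 / 2 < a" "a < 3 / 2" and pos: "0 < profile a 0 \<zeta> z"
  shows "cmod \<zeta> * cos (pi / (2 * a)) < Re \<zeta>"
proof -
  have c: "0 < cos (a * Arg \<zeta>)" and nz: "\<zeta> \<noteq> 0" using profile_pos_imp[OF a _ pos] by auto
  have "\<bar>Arg \<zeta>\<bar> < pi / (2 * a)"
  proof (rule ccontr)
    assume "\<not> \<bar>Arg \<zeta>\<bar> < pi / (2 * a)"
    then have 1: "pi / 2 \<le> a * \<bar>Arg \<zeta>\<bar>" using a by (simp add: field_simps)
    have "\<bar>Arg \<zeta>\<bar> \<le> pi" using mpi_less_Arg[of \<zeta>] Arg_le_pi[of \<zeta>] by auto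
    then have "a * \<bar>Arg \<zeta>\<bar> \<le> 3 / 2 * pi" using a by (intro mult_mono) auto
    then have "0 \<le> cos (a * \<bar>Arg \<zeta>\<bar> - pi)" using 1 by (intro cos_ge_zero) auto
    then have "cos (a * \<bar>Arg \<zeta>\<bar>) \<le> 0" by (simp add: cos_diff)
    then show False using c by (simp add: abs_if split: if_splits)
  qed
  then show ?thesis using a nz by (intro Re_gt_of_Arg) (auto simp: field_simps)
qed

text \<open>Both functions use the same profile. The first has its arc of longitudes in the plane of
  \<open>(x\<^sub>i, x\<^sub>j)\<close> around the positive \<open>x\<^sub>i\<close>-axis and is compressed in \<open>x\<^sub>k\<close>; the second has its arc in the
  plane of \<open>(x\<^sub>i, x\<^sub>k)\<close> around the negative \<open>x\<^sub>i\<close>-axis.\<close>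

lemma equal_degree_configuration:
  fixes i j k :: "'n::finite"
  assumes ijk: "i \<noteq> j" "i \<noteq> k" "j \<noteq> k"
  shows "\<exists>(A::real^'n^'n) C1 C2 u v \<alpha>. segregated_configuration A C1 C2 u v \<alpha> \<alpha>"
proof -
  obtain a \<epsilon> \<mu> \<tau> :: real where a: "1 / 2 < a" "a < 1" and \<epsilon>: "0 \<le> \<epsilon>" and \<mu>: "0 < \<mu>" "\<mu> < pi / 2"
    and \<tau>: "0 < \<tau>" "\<tau> * tan \<mu> < 1"
    and supp: "\<And>\<zeta> z. 0 < profile a \<epsilon> \<zeta> z \<Longrightarrow> - sin \<mu> * cmod \<zeta> < Re \<zeta> \<and> \<bar>z\<bar> < \<tau> * cmod \<zeta>"
    by (rule exists_narrow_profile) blast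
  obtain K where K: "0 < K" "\<And>x y z. \<lbrakk>- sin \<mu> * sqrt (x\<^sup>2 + y\<^sup>2) < x; \<bar>K * z\<bar> < \<tau> * sqrt (x\<^sup>2 + y\<^sup>2);
      - sin \<mu> * sqrt (x\<^sup>2 + z\<^sup>2) < - x; \<bar>y\<bar> < \<tau> * sqrt (x\<^sup>2 + z\<^sup>2)\<rbrakk> \<Longrightarrow> False"
    using crossed_cones_disjoint[OF \<mu> \<tau>] by blast
  define d e d' e' where "d = planar_dir i j 1 1" and "e = axial_dir k K"
    and "d' = planar_dir i k (- 1) 1" and "e' = axial_dir j (1::real)"
  define w where "w m = (if m = k then 1 / K\<^sup>2 else 1)" for m
  have "segregated_configuration (diag w) {x. 0 < cone_solution a \<epsilon> d e x} {x. 0 < cone_solution a \<epsilon> d' e' x}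
    (cone_solution a \<epsilon> d e) (cone_solution a \<epsilon> d' e') a a"
  proof (rule segregated_cone_solutions[where m = i and m' = i and s = 1 and s' = "- 1"])
    show "(\<Sum>m\<in>UNIV. w m * profile2 a \<epsilon> (d m) (e m) \<zeta> z) = 0" if "\<zeta> \<noteq> 0" for \<zeta> z
      unfolding w_def d_def e_def using ijk K(1) that by (intro spatial_equation) auto
    show "(\<Sum>m\<in>UNIV. profile2 a \<epsilon> (d' m) (e' m) \<zeta> z) = 0" if "\<zeta> \<noteq> 0" for \<zeta> z
      using spatial_equation[of i k j "- 1" 1 \<zeta> a \<epsilon> z] ijk that by (simp add: d'_def e'_def if_distrib cong: if_cong)
    fix x
    assume "0 < profile a \<epsilon> (clin d x) (rlin e x)" "0 < profile a \<epsilon> (clin d' x) (rlin e' x)"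
    then have "0 < profile a \<epsilon> (Complex (x $ i) (x $ j)) (K * x $ k)"
      "0 < profile a \<epsilon> (Complex (- x $ i) (x $ k)) (x $ j)"
      unfolding d_def e_def d'_def e'_def lin_dir[OF ijk(1)] lin_dir[OF ijk(2)] by simp_all
    from supp[OF this(1)] supp[OF this(2)] show False
      using K(2)[of "x $ i" "x $ j" "x $ k"] by (simp add: cmod_def)
  qed (use a \<epsilon> K ijk in \<open>auto simp: w_def d_def e_def d'_def e'_def planar_dir_def axial_dir_def\<close>)
  then show ?thesis by blast
qed

text \<open>Degree \<open>2/3\<close> gives a sector of opening \<open>3\<pi>/2\<close> around the negative \<open>x\<^sub>i\<close>-axis, whose complement is
  \<open>\<bar>x\<^sub>j\<bar> \<le> x\<^sub>i\<close>. Degree \<open>5/4\<close> gives half-opening \<open>2\<pi>/5\<close>, and the compression by \<open>c = cos (2\<pi>/5)\<close>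
  places that sector inside the complement.\<close>

lemma planar_configuration:
  fixes i j :: "'n::finite"
  assumes ij: "i \<noteq> j"
  shows "\<exists>(A::real^'n^'n) C1 C2 u v \<alpha>1 \<alpha>2. segregated_configuration A C1 C2 u v \<alpha>1 \<alpha>2"
proof -
  define c where "c = cos (2 * pi / 5)"
  have c: "0 < c" unfolding c_def by (intro cos_gt_zero) auto
  define d e d' where "d = planar_dir i j 1 (1 / c)" and "e = (\<lambda>m::'n. 0::real)"
    and "d' = planar_dir i j (- 1) (1::real)"
  define w where "w m = (if m = j then 1 / (1 / c)\<^sup>2 else 1)" for m
  have r0: "rlin e x = 0" for x by (simp add: rlin_def e_def)
  have "segregated_configuration (diag w) {x. 0 < cone_solution (5 / 4) 0 d e x} {x. 0 < cone_solution (2 / 3) 0 d' e x}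
    (cone_solution (5 / 4) 0 d e) (cone_solution (2 / 3) 0 d' e) (5 / 4) (2 / 3)"
  proof (rule segregated_cone_solutions[where m = i and m' = i and s = 1 and s' = "- 1"])
    show "(\<Sum>m\<in>UNIV. w m * profile2 (5 / 4) 0 (d m) (e m) \<zeta> z) = 0" for \<zeta> z
      unfolding w_def d_def e_def using ij c by (intro planar_equation) auto
    show "(\<Sum>m\<in>UNIV. profile2 (2 / 3) 0 (d' m) (e m) \<zeta> z) = 0" for \<zeta> z
      using planar_equation[of i j "- 1" 1 "2 / 3" \<zeta> z] ij by (simp add: d'_def e_def if_distrib cong: if_cong)
    fix x
    assume "0 < profile (5 / 4) 0 (clin d x) (rlin e x)" "0 < profile (2 / 3) 0 (clin d' x) (rlin e x)"
    then have p: "0 < profile (5 / 4) 0 (Complex (x $ i) (x $ j / c)) 0"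
      "0 < profile (2 / 3) 0 (Complex (- x $ i) (x $ j)) 0"
      unfolding d_def d'_def r0 lin_dir[OF ij] by simp_all
    have 1: "c * cmod (Complex (x $ i) (x $ j / c)) < x $ i"
      using planar_support[OF _ _ p(1)] by (simp add: c_def mult.commute)
    have "cos (3 * pi / 4) = cos (pi - pi / 4)" by (rule arg_cong[where f = cos]) simp
    also have "\<dots> = - (sqrt 2 / 2)" unfolding cos_diff by (simp add: cos_45)
    finally have "cos (3 * pi / 4) = - (sqrt 2 / 2)" .
    then have 2: "x $ i < sqrt 2 / 2 * cmod (Complex (x $ i) (x $ j))"
      using planar_support[OF _ _ p(2)] by (simp add: cmod_def mult.commute)
    have xi: "0 < x $ i" using 1 c by (meson le_less_trans less_imp_le mult_nonneg_nonneg norm_ge_zero)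
    have "\<bar>x $ j\<bar> = c * \<bar>Im (Complex (x $ i) (x $ j / c))\<bar>" using c by simp
    also have "\<dots> \<le> c * cmod (Complex (x $ i) (x $ j / c))" using c by (intro mult_left_mono abs_Im_le_cmod) auto
    finally have "\<bar>x $ j\<bar> < x $ i" using 1 by simp
    then have "(x $ j)\<^sup>2 \<le> (x $ i)\<^sup>2" using power_mono[of "\<bar>x $ j\<bar>" "x $ i" 2] by simp
    moreover have "(x $ i)\<^sup>2 < (sqrt 2 / 2 * cmod (Complex (x $ i) (x $ j)))\<^sup>2"
      using 2 xi by (intro power_strict_mono) auto
    then have "(x $ i)\<^sup>2 < ((x $ i)\<^sup>2 + (x $ j)\<^sup>2) / 2"
      by (simp add: power_mult_distrib power_divide cmod_def)
    ultimately show False by simp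
  qed (use c ij in \<open>auto simp: w_def d_def e_def d'_def planar_dir_def\<close>)
  then show ?thesis by blast
qed

theorem proposition3p7:
  assumes "CARD('n::finite) \<ge> 2"
  shows "(\<exists>(A::real^'n^'n) C1 C2 u v \<alpha>1 \<alpha>2. segregated_configuration A C1 C2 u v \<alpha>1 \<alpha>2) \<and>
    (CARD('n) \<ge> 3 \<longrightarrow>
      (\<exists>(A::real^'n^'n) C1 C2 u v \<alpha>1 \<alpha>2.
         segregated_configuration A C1 C2 u v \<alpha>1 \<alpha>2 \<and> \<alpha>1 = \<alpha>2))"
proof (intro conjI impI)
  obtain S :: "'n set" where "card S = 2"
    using obtain_subset_with_card_n[OF assms] by blast
  then obtain i j :: 'n where "i \<noteq> j" by (auto simp: card_2_iff)
  then show "\<exists>(A::real^'n^'n) C1 C2 u v \<alpha>1 \<alpha>2. segregated_configuration A C1 C2 u v \<alpha>1 \<alpha>2"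
    by (rule planar_configuration)
next
  assume "CARD('n) \<ge> 3"
  then obtain S :: "'n set" where "card S = 3"
    using obtain_subset_with_card_n by blast
  then obtain i j k :: 'n where "i \<noteq> j" "i \<noteq> k" "j \<noteq> k" by (auto simp: card_3_iff)
  then show "\<exists>(A::real^'n^'n) C1 C2 u v \<alpha>1 \<alpha>2. segregated_configuration A C1 C2 u v \<alpha>1 \<alpha>2 \<and> \<alpha>1 = \<alpha>2"
    using equal_degree_configuration[of i j k] by blast
qed

end
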